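(* Let $\varphi\in(0,1)$ with $\varphi=\Omega(1)$ and $d=O(1)$. Let $X$ be a uniformly random bit. If $X=0$, the input is a $d$-regular $\varphi$-expander on $2n$ vertices. If $X=1$, pair the vertices as $\{1,2\},\{3,4\},\dots,\{2n-1,2n\}$, for each pair $\{2i-1,2i\}$ pick an independent uniformly random $Y_i\in\{\pm1\}$, put $2i-1$ in set 1 and $2i$ in set 2 if $Y_i=1$ and the reverse otherwise, and the input is a $d$-regular graph consisting of two identical $\varphi$-expanders on set 1 and on set 2. Let $\mathcal A$ be an algorithm that accesses the graph only through $T$ random walk queries, uses $M$ bits of space, and determines $X$ with error probability at most $1/3$. Then $M\cdot T=\Omega(n)$.
   Context: The conductance of $G$ is $\phi(G)=\min_{C\subseteq V,\,0<\mathrm{vol}(C)\le\mathrm{vol}(V)/2}|E(C,V\setminus C)|/\mathrm{vol}(C)$ with $\mathrm{vol}(C)=\sum_{v\in C}d_v$; $G$ is a $\varphi$-expander if $\phi(G)\ge\varphi$. A random walk query, for a specified starting vertex $x$, returns the endpoint of an $O(\log n)$-step lazy random walk from $x$ (at each step the walk stays put with probability $1/2$ and otherwise moves to a uniformly random neighbor).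
   Formalization: The O(log n)-step walk is taken to have length at least C₀ ln n for a sufficiently large constant C₀ depending on the lower bound for φ (long enough to mix); for very short walks, e.g. one step, the claim fails. *)

theory Defs
  imports "HOL-Probability.Probability" "HOL-Probability.Product_PMF" "Graph_Theory.Graph_Theory"
begin

section \<open>Expanders\<close>

text \<open>
  Finite simple undirected graphs are the \<^locale>\<open>pair_graph\<close>s of the library: every edge is
  represented by its two arcs, so the out-degree of a vertex is its degree, and the arcs
  leaving \<open>C\<close> are in bijection with the edges in \<open>E(C, V - C)\<close>.
\<close>

definition regular_graph :: "nat \<Rightarrow> 'a pair_pre_digraph \<Rightarrow> bool" where
  "regular_graph d G \<longleftrightarrow> pair_graph G \<and> (\<forall>v\<in>pverts G. out_degree (with_proj G) v = d)"

definition vol :: "'a pair_pre_digraph \<Rightarrow> 'a set \<Rightarrow> nat" where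
  "vol G C = (\<Sum>v\<in>C. out_degree (with_proj G) v)"

definition cut_size :: "'a pair_pre_digraph \<Rightarrow> 'a set \<Rightarrow> nat" where
  "cut_size G C = card {(u, v) \<in> parcs G. u \<in> C \<and> v \<in> pverts G - C}"

definition conductance :: "'a pair_pre_digraph \<Rightarrow> real" where
  "conductance G =
     Min {real (cut_size G C) / real (vol G C) | C.
            C \<subseteq> pverts G \<and> 0 < vol G C \<and> real (vol G C) \<le> real (vol G (pverts G)) / 2}"

definition expander :: "real \<Rightarrow> 'a pair_pre_digraph \<Rightarrow> bool" where
  "expander \<phi> G \<longleftrightarrow> conductance G \<ge> \<phi>"

section \<open>Random walk queries\<close>

definition lazy_step :: "'a pair_pre_digraph \<Rightarrow> 'a \<Rightarrow> 'a pmf" where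
  "lazy_step G v =
     bernoulli_pmf (1/2) \<bind> (\<lambda>stay.
       if stay then return_pmf v else pmf_of_set {w. (v, w) \<in> parcs G})"

primrec lazy_walk :: "'a pair_pre_digraph \<Rightarrow> nat \<Rightarrow> 'a \<Rightarrow> 'a pmf" where
  "lazy_walk G 0 x = return_pmf x"
| "lazy_walk G (Suc l) x = lazy_walk G l x \<bind> lazy_step G"

section \<open>Space-bounded query algorithms\<close>

text \<open>
  Between two queries a program remembers only its memory contents, a bit string.  In round
  \<open>t\<close> with memory \<open>s\<close> it queries the vertex \<open>query P t s\<close>, and on the answer \<open>y\<close> its memory
  becomes \<open>update P t s y\<close>; after the last round it outputs \<open>verdict P s\<close>.  The round number
  is available without being stored, and computation within a round is not charged for.  A
  randomized algorithm is a probability distribution over programs, so that its random coins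
  are not charged for either.
\<close>

record rw_program =
  start :: "bool list"
  query :: "nat \<Rightarrow> bool list \<Rightarrow> nat"
  update :: "nat \<Rightarrow> bool list \<Rightarrow> nat \<Rightarrow> bool list"
  verdict :: "bool list \<Rightarrow> bool"

definition uses_space :: "rw_program \<Rightarrow> nat \<Rightarrow> bool" where
  "uses_space P M \<longleftrightarrow>
     length (start P) = M \<and> (\<forall>t s y. length s = M \<longrightarrow> length (update P t s y) = M)"

definition queries_within :: "rw_program \<Rightarrow> nat \<Rightarrow> nat set \<Rightarrow> bool" where
  "queries_within P M V \<longleftrightarrow> (\<forall>t s. length s = M \<longrightarrow> query P t s \<in> V)"

text \<open>Distribution of the memory contents after \<open>T\<close> queries answered by walks of length \<open>l\<close>.\<close>

primrec memory_after :: "nat pair_pre_digraph \<Rightarrow> nat \<Rightarrow> rw_program \<Rightarrow> nat \<Rightarrow> bool list pmf" where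
  "memory_after G l P 0 = return_pmf (start P)"
| "memory_after G l P (Suc T) =
     memory_after G l P T \<bind> (\<lambda>s. map_pmf (update P T s) (lazy_walk G l (query P T s)))"

section \<open>The input distribution\<close>

definition random_signs :: "nat \<Rightarrow> (nat \<Rightarrow> int) pmf" where
  "random_signs n = Pi_pmf {1..n} 1 (\<lambda>_. pmf_of_set {-1, 1})"

definition set1 :: "nat \<Rightarrow> (nat \<Rightarrow> int) \<Rightarrow> nat set" where
  "set1 n Y = (\<lambda>i. if Y i = 1 then 2 * i - 1 else 2 * i) ` {1..n}"

definition set2 :: "nat \<Rightarrow> (nat \<Rightarrow> int) \<Rightarrow> nat set" where
  "set2 n Y = (\<lambda>i. if Y i = 1 then 2 * i else 2 * i - 1) ` {1..n}"

text \<open>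
  Identical means isomorphic; copying one graph along the index \<open>i\<close> of the pairs is a special
  case.
\<close>

definition two_identical_expanders ::
    "real \<Rightarrow> nat set \<Rightarrow> nat set \<Rightarrow> nat pair_pre_digraph \<Rightarrow> bool" where
  "two_identical_expanders \<phi> S1 S2 G \<longleftrightarrow>
     (\<exists>H1 H2. pair_graph H1 \<and> pair_graph H2 \<and> pverts H1 = S1 \<and> pverts H2 = S2 \<and>
        expander \<phi> H1 \<and> expander \<phi> H2 \<and> digraph_iso (with_proj H1) (with_proj H2) \<and>
        pverts G = S1 \<union> S2 \<and> parcs G = parcs H1 \<union> parcs H2)"

text \<open>
  \<open>G0\<close> is the input for \<open>X = 0\<close> and \<open>G1 Y\<close> the input for \<open>X = 1\<close> and signs \<open>Y\<close>; the bit \<open>X\<close> is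
  a truth value, with \<open>True\<close> for 1.
\<close>

definition input_graph ::
    "nat \<Rightarrow> nat pair_pre_digraph \<Rightarrow> ((nat \<Rightarrow> int) \<Rightarrow> nat pair_pre_digraph) \<Rightarrow>
     bool \<Rightarrow> nat pair_pre_digraph pmf" where
  "input_graph n G0 G1 X = (if X then map_pmf G1 (random_signs n) else return_pmf G0)"

definition error_prob ::
    "nat \<Rightarrow> nat pair_pre_digraph \<Rightarrow> ((nat \<Rightarrow> int) \<Rightarrow> nat pair_pre_digraph) \<Rightarrow>
     nat \<Rightarrow> rw_program pmf \<Rightarrow> nat \<Rightarrow> real" where
  "error_prob n G0 G1 l \<A> T =
     measure_pmf.prob
       (pmf_of_set (UNIV :: bool set) \<bind> (\<lambda>X.
        input_graph n G0 G1 X \<bind> (\<lambda>G.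
        \<A> \<bind> (\<lambda>P.
        map_pmf (\<lambda>s. (X, verdict P s)) (memory_after G l P T)))))
       {(X, guess). guess \<noteq> X}"

end

theory Submission
  imports Defs
begin

text \<open>
  By Cheeger's inequality, a lazy walk of length at least \<open>16 ln n / \<phi>\<^sub>0\<^sup>2\<close> ends within distance
  \<open>O(1 / n)\<close> of the uniform distribution on its connected component, so while \<open>T\<close> is a small fraction
  of \<open>n\<close> the answers may be taken to be exactly uniform on the component.

  For \<open>X = 0\<close> such an answer carries no information.  For \<open>X = 1\<close>, a query in pair \<open>i\<close> reveals a
  uniformly random pair \<open>j\<close> together with the product \<open>Y\<^sub>i Y\<^sub>j\<close>.  Conditioned on a memory state of
  probability \<open>p\<close>, the squared biases of these products add up to \<open>O(1 + ln (1 / p))\<close>, by the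
  level-one inequality on the cube, so the answer has relative entropy \<open>O((1 + ln (1 / p)) / n)\<close>
  to the uniform distribution.  The average of \<open>ln (1 / p)\<close> over the states is at most the entropy
  bound \<open>M ln 2\<close>, and by the chain rule the memory contents for \<open>X = 1\<close> and \<open>X = 0\<close> differ by
  \<open>O(M T / n)\<close> in relative entropy after \<open>T\<close> queries.
\<close>

section \<open>Total variation and relative entropy\<close>

lemma expectation_eq_sum_pmf:
  fixes f :: "'a \<Rightarrow> real"
  assumes "finite S" "set_pmf p \<subseteq> S"
  shows "measure_pmf.expectation p f = (\<Sum>s\<in>S. pmf p s * f s)"
  using assms by (subst integral_measure_pmf_real[of S]) (auto simp: mult.commute)

lemma integrable_pmf_bounded:
  fixes f :: "'a \<Rightarrow> real"
  assumes "bounded (range f)"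
  shows "integrable (measure_pmf p) f"
proof -
  obtain B where "\<And>x. norm (f x) \<le> B" using assms by (auto simp: bounded_iff)
  then show ?thesis by (intro measure_pmf.integrable_const_bound[where B = B]) auto
qed

lemma expectation_bind_pmf:
  fixes f :: "'b \<Rightarrow> real"
  assumes "bounded (range f)"
  shows "measure_pmf.expectation (p \<bind> k) f
    = measure_pmf.expectation p (\<lambda>x. measure_pmf.expectation (k x) f)"
proof -
  obtain B where "\<And>y. \<bar>f y\<bar> \<le> B" using assms by (auto simp: bounded_iff)
  then show ?thesis
    unfolding measure_pmf_bind using measurable_measure_pmf[of k]
    by (intro integral_bind[where K = "count_space UNIV" and B = B and B' = 1])
       (auto intro: measure_pmf.finite_measure_axioms)
qed

lemma abs_expectation_le:
  fixes f :: "'a \<Rightarrow> real"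
  assumes abs_le: "\<And>x. \<bar>f x\<bar> \<le> B"
  shows "\<bar>measure_pmf.expectation p f\<bar> \<le> B"
proof -
  have "bounded (range f)" using abs_le by (auto simp: bounded_iff)
  then have "measure_pmf.expectation p (\<lambda>x. \<bar>f x\<bar>) \<le> measure_pmf.expectation p (\<lambda>_. B)"
    using abs_le by (intro integral_mono integrable_abs integrable_pmf_bounded) auto
  then show ?thesis by (intro order_trans[OF integral_abs_bound]) simp
qed

lemma bounded_range_indicator: "bounded (range (indicator A :: 'a \<Rightarrow> real))"
  by (auto simp: bounded_iff indicator_def intro: exI[of _ 1])

lemma bounded_range_exp:
  fixes g :: "'a \<Rightarrow> real"
  assumes "bounded (range g)"
  shows "bounded (range (\<lambda>x. exp (g x)))"
proof -
  obtain B where "\<And>x. \<bar>g x\<bar> \<le> B" using assms by (auto simp: bounded_iff)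
  then have "\<bar>exp (g x)\<bar> \<le> exp B" for x by (auto intro: order_trans[OF abs_ge_self])
  then show ?thesis by (auto simp: bounded_iff)
qed

lemma bounded_range_expectation:
  fixes f :: "'b \<Rightarrow> real"
  assumes "bounded (range f)"
  shows "bounded (range (\<lambda>x. measure_pmf.expectation (k x) f))"
proof -
  obtain B where "\<And>y. \<bar>f y\<bar> \<le> B" using assms by (auto simp: bounded_iff)
  then have "\<bar>measure_pmf.expectation (k x) f\<bar> \<le> B" for x by (rule abs_expectation_le)
  then show ?thesis by (auto simp: bounded_iff)
qed

lemma bounded_range_pmf_mult_expectation:
  fixes f :: "'b \<Rightarrow> real"
  assumes "bounded (range f)"
  shows "bounded (range (\<lambda>y. pmf (m y) s * measure_pmf.expectation (k y) f))"
proof -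
  obtain B where "\<And>a. \<bar>f a\<bar> \<le> B" using assms by (auto simp: bounded_iff)
  then have "\<bar>pmf (m y) s * measure_pmf.expectation (k y) f\<bar> \<le> 1 * B" for y
    unfolding abs_mult by (intro mult_mono abs_expectation_le) (auto simp: pmf_le_1)
  then show ?thesis by (auto simp: bounded_iff)
qed

lemma expectation_exp_pos:
  fixes g :: "'a \<Rightarrow> real"
  assumes "integrable (measure_pmf p) (\<lambda>x. exp (g x))"
  shows "0 < measure_pmf.expectation p (\<lambda>x. exp (g x))"
proof -
  have "measure_pmf.expectation p (\<lambda>x. exp (g x)) \<noteq> 0"
    using integral_nonneg_eq_0_iff_AE[OF assms] set_pmf_not_empty[of p]
    by (auto simp: AE_measure_pmf_iff)
  moreover have "0 \<le> measure_pmf.expectation p (\<lambda>x. exp (g x))" by simp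
  ultimately show ?thesis by linarith
qed

lemma bounded_range_ln_expectation_exp:
  fixes g :: "'b \<Rightarrow> real"
  assumes "bounded (range g)"
  shows "bounded (range (\<lambda>x. ln (measure_pmf.expectation (k x) (\<lambda>y. exp (g y)))))"
proof -
  obtain B where abs_le: "\<And>y. \<bar>g y\<bar> \<le> B" using assms by (auto simp: bounded_iff)
  have integrable: "integrable (measure_pmf p) (\<lambda>y. exp (g y))" for p
    by (intro integrable_pmf_bounded bounded_range_exp assms)
  have "\<bar>ln (measure_pmf.expectation (k x) (\<lambda>y. exp (g y)))\<bar> \<le> B" for x
  proof -
    let ?E = "measure_pmf.expectation (k x)"
    have g_bounds: "- B \<le> g y" "g y \<le> B" for y using abs_le[of y] by auto
    have "?E (\<lambda>_. exp (- B)) \<le> ?E (\<lambda>y. exp (g y))" "?E (\<lambda>y. exp (g y)) \<le> ?E (\<lambda>_. exp B)"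
      using g_bounds by (intro integral_mono integrable; simp)+
    then show ?thesis
      using expectation_exp_pos[OF integrable, of "k x"] ln_le_cancel_iff[of _ "exp B"]
      by (simp add: abs_le_iff ln_ge_iff minus_le_iff)
  qed
  then show ?thesis by (auto simp: bounded_iff)
qed

definition tv_dist_le :: "'a pmf \<Rightarrow> 'a pmf \<Rightarrow> real \<Rightarrow> bool" where
  "tv_dist_le p q \<epsilon> \<longleftrightarrow> (\<forall>h. range h \<subseteq> {0..1} \<longrightarrow>
     \<bar>measure_pmf.expectation p h - measure_pmf.expectation q h\<bar> \<le> \<epsilon>)"

lemma tv_dist_leD:
  assumes "tv_dist_le p q \<epsilon>" "\<And>x. 0 \<le> h x" "\<And>x. h x \<le> 1"
  shows "\<bar>measure_pmf.expectation p h - measure_pmf.expectation q h\<bar> \<le> \<epsilon>"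
  using assms by (auto simp: tv_dist_le_def image_subset_iff)

lemma tv_dist_le_refl: "tv_dist_le p p 0"
  by (simp add: tv_dist_le_def)

lemma tv_dist_le_mono: "tv_dist_le p q \<epsilon> \<Longrightarrow> \<epsilon> \<le> \<epsilon>' \<Longrightarrow> tv_dist_le p q \<epsilon>'"
  unfolding tv_dist_le_def by (meson order_trans)

lemma tv_dist_le_prob:
  assumes "tv_dist_le p q \<epsilon>"
  shows "\<bar>measure_pmf.prob p A - measure_pmf.prob q A\<bar> \<le> \<epsilon>"
  using tv_dist_leD[OF assms, of "indicator A"] by simp

lemma tv_dist_le_map:
  assumes "tv_dist_le p q \<epsilon>"
  shows "tv_dist_le (map_pmf f p) (map_pmf f q) \<epsilon>"
  using assms by (auto simp: tv_dist_le_def image_subset_iff)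

lemma tv_dist_le_bind:
  assumes start: "tv_dist_le p q \<alpha>" and step: "\<And>x. x \<in> set_pmf q \<Longrightarrow> tv_dist_le (f x) (g x) \<beta>"
  shows "tv_dist_le (p \<bind> f) (q \<bind> g) (\<alpha> + \<beta>)"
  unfolding tv_dist_le_def
proof (intro allI impI)
  fix h :: "'b \<Rightarrow> real" assume h: "range h \<subseteq> {0..1}"
  then have bounded: "bounded (range h)" by (rule bounded_subset[rotated]) simp
  note integrable = integrable_pmf_bounded[OF bounded_range_expectation[OF bounded]]
  let ?F = "\<lambda>x. measure_pmf.expectation (f x) h" and ?G = "\<lambda>x. measure_pmf.expectation (g x) h"
  have F_range: "0 \<le> ?F x" "?F x \<le> 1" for x
    using h abs_expectation_le[of h 1 "f x"] by (auto simp: image_subset_iff)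
  have "\<bar>measure_pmf.expectation q ?F - measure_pmf.expectation q ?G\<bar>
    \<le> measure_pmf.expectation q (\<lambda>x. \<bar>?F x - ?G x\<bar>)"
    unfolding Bochner_Integration.integral_diff[OF integrable integrable, symmetric]
    by (rule integral_abs_bound)
  also have "\<dots> \<le> measure_pmf.expectation q (\<lambda>_. \<beta>)"
    using step h by (intro integral_mono_AE AE_pmfI) (auto simp: integrable tv_dist_le_def)
  finally have "\<bar>measure_pmf.expectation q ?F - measure_pmf.expectation q ?G\<bar> \<le> \<beta>" by simp
  then show "\<bar>measure_pmf.expectation (p \<bind> f) h - measure_pmf.expectation (q \<bind> g) h\<bar> \<le> \<alpha> + \<beta>"
    using tv_dist_leD[OF start, of ?F] F_range by (simp add: expectation_bind_pmf[OF bounded])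
qed

lemma tv_dist_le_l1:
  assumes "finite W" "set_pmf p \<subseteq> W" "set_pmf q \<subseteq> W"
  shows "tv_dist_le p q (\<Sum>a\<in>W. \<bar>pmf p a - pmf q a\<bar>)"
  unfolding tv_dist_le_def
proof (intro allI impI)
  fix h :: "'a \<Rightarrow> real" assume h: "range h \<subseteq> {0..1}"
  have "\<bar>measure_pmf.expectation p h - measure_pmf.expectation q h\<bar>
    = \<bar>\<Sum>a\<in>W. (pmf p a - pmf q a) * h a\<bar>"
    using assms by (simp add: expectation_eq_sum_pmf[of W] left_diff_distrib sum_subtractf)
  also have "\<dots> \<le> (\<Sum>a\<in>W. \<bar>(pmf p a - pmf q a) * h a\<bar>)" by (rule sum_abs)
  also have "\<dots> \<le> (\<Sum>a\<in>W. \<bar>pmf p a - pmf q a\<bar>)"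
    using h by (intro sum_mono) (auto simp: abs_mult image_subset_iff intro!: mult_right_le_one_le)
  finally show "\<bar>measure_pmf.expectation p h - measure_pmf.expectation q h\<bar>
    \<le> (\<Sum>a\<in>W. \<bar>pmf p a - pmf q a\<bar>)" .
qed

text \<open>
  By the Donsker--Varadhan variational formula this says that the relative entropy of \<open>p\<close> with
  respect to \<open>q\<close> is at most \<open>\<kappa>\<close>; in this form no absolute continuity has to be tracked.
\<close>

definition relative_entropy_le :: "'a pmf \<Rightarrow> 'a pmf \<Rightarrow> real \<Rightarrow> bool" where
  "relative_entropy_le p q \<kappa> \<longleftrightarrow> (\<forall>g. bounded (range g) \<longrightarrow>
     measure_pmf.expectation p g \<le> ln (measure_pmf.expectation q (\<lambda>x. exp (g x))) + \<kappa>)"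

lemma relative_entropy_le_return: "relative_entropy_le (return_pmf x) (return_pmf x) 0"
  by (simp add: relative_entropy_le_def)

lemma relative_entropy_le_mono:
  "relative_entropy_le p q \<kappa> \<Longrightarrow> \<kappa> \<le> \<kappa>' \<Longrightarrow> relative_entropy_le p q \<kappa>'"
  unfolding relative_entropy_le_def by (meson add_left_mono order_trans)

lemma relative_entropy_le_prob:
  assumes entropy: "relative_entropy_le p q \<kappa>" and \<delta>_range: "0 < \<delta>" "\<delta> \<le> 1"
  shows "measure_pmf.prob p A \<le> measure_pmf.prob q A + \<delta> + \<kappa> / \<delta>"
proof -
  let ?P = "measure_pmf.prob p A" and ?Q = "measure_pmf.prob q A"
  let ?g = "\<lambda>x. \<delta> * indicator A x :: real"
  have g_bounded: "bounded (range ?g)" using \<delta>_range by (auto simp: bounded_iff indicator_def)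
  note integrable = integrable_pmf_bounded[OF bounded_range_exp[OF g_bounded], of q]
    integrable_pmf_bounded[OF bounded_range_indicator[of A], of q]
  have "measure_pmf.expectation q (\<lambda>x. exp (?g x))
    \<le> measure_pmf.expectation q (\<lambda>x. 1 + (\<delta> + \<delta>\<^sup>2) * indicator A x)"
  proof (intro integral_mono integrable(1))
    show "exp (?g x) \<le> 1 + (\<delta> + \<delta>\<^sup>2) * indicator A x" for x
      using exp_bound[of \<delta>] \<delta>_range by (simp add: indicator_def)
  qed (simp add: integrable)
  also have "\<dots> = 1 + (\<delta> + \<delta>\<^sup>2) * ?Q" by (simp add: integrable)
  finally have "ln (measure_pmf.expectation q (\<lambda>x. exp (?g x))) \<le> (\<delta> + \<delta>\<^sup>2) * ?Q"
    using ln_le_minus_one[OF expectation_exp_pos[OF integrable(1)]] by simp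
  also have "\<dots> \<le> \<delta> * ?Q + \<delta>\<^sup>2"
    using mult_left_mono[OF measure_pmf.prob_le_1[of q A], of "\<delta>\<^sup>2"] by (simp add: algebra_simps)
  finally have "\<delta> * ?P \<le> \<delta> * ?Q + \<delta>\<^sup>2 + \<kappa>"
    using entropy[unfolded relative_entropy_le_def, rule_format, OF g_bounded] by simp
  then have "\<delta> * ?P \<le> \<delta> * (?Q + \<delta> + \<kappa> / \<delta>)"
    using \<delta>_range by (simp add: power2_eq_square distrib_left)
  then show ?thesis using \<delta>_range by simp
qed

text \<open>The chain rule, when the steps \<open>k\<close> depend on a hidden \<open>y\<close> about which the state is informative.\<close>

lemma relative_entropy_le_bind:
  fixes m :: "'y \<Rightarrow> 's pmf" and k :: "'y \<Rightarrow> 's \<Rightarrow> 'a pmf"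
  assumes states: "finite S" "\<And>y. set_pmf (m y) \<subseteq> S"
    and start: "relative_entropy_le (\<mu> \<bind> m) q \<kappa>"
    and step: "\<And>s g. s \<in> S \<Longrightarrow> bounded (range g) \<Longrightarrow>
      measure_pmf.expectation \<mu> (\<lambda>y. pmf (m y) s * measure_pmf.expectation (k y s) g)
        \<le> pmf (\<mu> \<bind> m) s * ln (measure_pmf.expectation (k' s) (\<lambda>a. exp (g a))) + \<eta> s"
  shows "relative_entropy_le (\<mu> \<bind> (\<lambda>y. m y \<bind> k y)) (q \<bind> k') (\<kappa> + (\<Sum>s\<in>S. \<eta> s))"
  unfolding relative_entropy_le_def
proof (intro allI impI)
  fix g :: "'a \<Rightarrow> real" assume g_bounded: "bounded (range g)"
  define g' where "g' s = ln (measure_pmf.expectation (k' s) (\<lambda>a. exp (g a)))" for s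
  have g'_bounded: "bounded (range g')"
    unfolding g'_def by (rule bounded_range_ln_expectation_exp[OF g_bounded])
  have exp_g': "exp (g' s) = measure_pmf.expectation (k' s) (\<lambda>a. exp (g a))" for s
    unfolding g'_def
    by (intro exp_ln expectation_exp_pos integrable_pmf_bounded bounded_range_exp g_bounded)
  have support: "set_pmf (\<mu> \<bind> m) \<subseteq> S" using states(2) by auto
  have "measure_pmf.expectation (\<mu> \<bind> (\<lambda>y. m y \<bind> k y)) g
    = measure_pmf.expectation \<mu> (\<lambda>y. \<Sum>s\<in>S. pmf (m y) s * measure_pmf.expectation (k y s) g)"
    by (simp add: expectation_bind_pmf[OF g_bounded] expectation_eq_sum_pmf[OF states])
  also have "\<dots> = (\<Sum>s\<in>S. measure_pmf.expectation \<mu>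
      (\<lambda>y. pmf (m y) s * measure_pmf.expectation (k y s) g))"
    by (intro Bochner_Integration.integral_sum integrable_pmf_bounded
        bounded_range_pmf_mult_expectation g_bounded)
  also have "\<dots> \<le> (\<Sum>s\<in>S. pmf (\<mu> \<bind> m) s * g' s + \<eta> s)"
    unfolding g'_def by (intro sum_mono step g_bounded)
  also have "\<dots> = measure_pmf.expectation (\<mu> \<bind> m) g' + (\<Sum>s\<in>S. \<eta> s)"
    by (simp add: expectation_eq_sum_pmf[OF states(1) support] sum.distrib)
  also have "measure_pmf.expectation (\<mu> \<bind> m) g'
    \<le> ln (measure_pmf.expectation q (\<lambda>s. exp (g' s))) + \<kappa>"
    using start g'_bounded by (simp add: relative_entropy_le_def)
  also have "measure_pmf.expectation q (\<lambda>s. exp (g' s))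
    = measure_pmf.expectation (q \<bind> k') (\<lambda>a. exp (g a))"
    by (simp add: exp_g' expectation_bind_pmf[OF bounded_range_exp[OF g_bounded]])
  finally show "measure_pmf.expectation (\<mu> \<bind> (\<lambda>y. m y \<bind> k y)) g
    \<le> ln (measure_pmf.expectation (q \<bind> k') (\<lambda>a. exp (g a))) + (\<kappa> + (\<Sum>s\<in>S. \<eta> s))"
    by simp
qed

section \<open>The log-sum inequality\<close>

lemma mult_ln_div_le:
  fixes r h c :: real
  assumes "0 \<le> r" "0 \<le> h" "0 < r \<Longrightarrow> 0 < h" "0 < c"
  shows "r * ln (h / r) \<le> r * ln c + (h / c - r)"
proof (cases "r = 0")
  case False
  with assms have pos: "0 < r" "0 < h" by auto
  then have "r * ln (h / r) = r * ln c + r * ln (h / (c * r))"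
    using \<open>0 < c\<close> by (simp add: ln_div ln_mult algebra_simps)
  also have "\<dots> \<le> r * ln c + r * (h / (c * r) - 1)"
    using pos \<open>0 < c\<close> by (intro add_left_mono mult_left_mono ln_le_minus_one) auto
  also have "r * (h / (c * r) - 1) = h / c - r"
    using pos by (simp add: right_diff_distrib)
  finally show ?thesis .
qed (use assms in simp)

lemma log_sum_inequality:
  fixes r h :: "'a \<Rightarrow> real"
  assumes "finite A" and nonneg: "\<And>a. a \<in> A \<Longrightarrow> 0 \<le> r a" "\<And>a. a \<in> A \<Longrightarrow> 0 \<le> h a"
    and pos: "\<And>a. a \<in> A \<Longrightarrow> 0 < r a \<Longrightarrow> 0 < h a"
  shows "(\<Sum>a\<in>A. r a * ln (h a / r a)) \<le> sum r A * ln (sum h A / sum r A)"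
proof (cases "\<exists>a\<in>A. 0 < r a")
  case False
  then have "\<forall>a\<in>A. r a = 0" using nonneg(1) by force
  then show ?thesis by simp
next
  case True
  then obtain a where "a \<in> A" "0 < r a" by blast
  with \<open>finite A\<close> nonneg pos have sums_pos: "0 < sum r A" "0 < sum h A"
    by (auto intro!: sum_pos2[of A a])
  let ?c = "sum h A / sum r A"
  have "(\<Sum>a\<in>A. r a * ln (h a / r a)) \<le> (\<Sum>a\<in>A. r a * ln ?c + (h a / ?c - r a))"
    using sums_pos by (intro sum_mono mult_ln_div_le nonneg pos) auto
  also have "\<dots> = sum r A * ln ?c + (sum h A / ?c - sum r A)"
    by (simp only: sum.distrib sum_subtractf sum_distrib_right[symmetric] sum_divide_distrib[symmetric])
  also have "sum h A / ?c - sum r A = 0" using sums_pos by simp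
  finally show ?thesis by simp
qed

lemma entropy_le_ln_card:
  fixes p :: "'a \<Rightarrow> real"
  assumes "finite A" "\<And>a. a \<in> A \<Longrightarrow> 0 \<le> p a" "(\<Sum>a\<in>A. p a) = 1"
  shows "(\<Sum>a\<in>A. p a * ln (1 / p a)) \<le> ln (card A)"
  using log_sum_inequality[of A p "\<lambda>_. 1"] assms by simp

lemma sum_mult_le_chi_square:
  fixes r g :: "'a \<Rightarrow> real"
  assumes "finite A" and nonneg: "\<And>a. a \<in> A \<Longrightarrow> 0 \<le> r a"
  defines "R \<equiv> sum r A"
  shows "(\<Sum>a\<in>A. r a * g a)
    \<le> R * ln ((\<Sum>a\<in>A. exp (g a)) / card A) + (card A * (\<Sum>a\<in>A. (r a)\<^sup>2) / R - R)"
proof (cases "\<exists>a\<in>A. 0 < r a")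
  case False
  then have "\<forall>a\<in>A. r a = 0" using nonneg by force
  then show ?thesis by (simp add: R_def)
next
  case True
  define N Z Q where "N = real (card A)" and "Z = (\<Sum>a\<in>A. exp (g a))" and "Q = (\<Sum>a\<in>A. (r a)\<^sup>2)"
  from True obtain a where "a \<in> A" "0 < r a" by blast
  with \<open>finite A\<close> nonneg have pos: "0 < R" "0 < Q" "0 < Z" "0 < N"
    unfolding R_def Q_def Z_def N_def by (auto intro!: sum_pos2[of A a] simp: card_gt_0_iff)
  have "(\<Sum>a\<in>A. r a * g a) = (\<Sum>a\<in>A. r a * ln (exp (g a) / r a)) + (\<Sum>a\<in>A. r a * ln ((r a)\<^sup>2 / r a))"
    unfolding sum.distrib[symmetric]
  proof (rule sum.cong[OF refl])
    fix a assume "a \<in> A"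
    then consider "r a = 0" | "0 < r a" using nonneg by force
    then show "r a * g a = r a * ln (exp (g a) / r a) + r a * ln ((r a)\<^sup>2 / r a)"
      by cases (simp_all add: ln_div power2_eq_square algebra_simps)
  qed
  also have "\<dots> \<le> R * ln (Z / R) + R * ln (Q / R)"
    unfolding R_def Z_def Q_def using \<open>finite A\<close> nonneg by (intro add_mono log_sum_inequality) auto
  also have "\<dots> = R * ln (Z / N) + R * ln (N * Q / R\<^sup>2)"
    using pos by (simp add: ln_div ln_mult ln_realpow algebra_simps)
  also have "\<dots> \<le> R * ln (Z / N) + R * (N * Q / R\<^sup>2 - 1)"
    using pos by (intro add_left_mono mult_left_mono ln_le_minus_one) auto
  also have "R * (N * Q / R\<^sup>2 - 1) = N * Q / R - R"
    using pos by (simp add: field_simps power2_eq_square)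
  finally show ?thesis by (simp add: N_def Z_def Q_def)
qed

lemma expectation_mult_le_ln_mgf:
  fixes w g :: "'a \<Rightarrow> real"
  assumes finite_support: "finite (set_pmf \<mu>)" and w_range: "\<And>y. 0 \<le> w y" "\<And>y. w y \<le> 1"
  defines "p \<equiv> measure_pmf.expectation \<mu> w"
  shows "measure_pmf.expectation \<mu> (\<lambda>y. w y * g y)
    \<le> p * ln (measure_pmf.expectation \<mu> (\<lambda>y. exp (g y)) / p)"
proof -
  let ?S = "set_pmf \<mu>"
  have "(\<Sum>y\<in>?S. pmf \<mu> y * (w y * g y))
    \<le> (\<Sum>y\<in>?S. (pmf \<mu> y * w y) * ln ((pmf \<mu> y * exp (g y)) / (pmf \<mu> y * w y)))"
  proof (intro sum_mono)
    fix y assume y: "y \<in> ?S"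
    have "w y * g y \<le> w y * ln (exp (g y) / w y)"
    proof (cases "w y = 0")
      case False
      with w_range have "0 < w y" "ln (w y) \<le> 0" by (auto simp: less_le)
      then show ?thesis by (intro mult_left_mono) (auto simp: ln_div)
    qed simp
    then show "pmf \<mu> y * (w y * g y) \<le> (pmf \<mu> y * w y) * ln ((pmf \<mu> y * exp (g y)) / (pmf \<mu> y * w y))"
      using y by (simp add: mult.assoc mult_left_mono set_pmf_iff)
  qed
  also have "\<dots> \<le> (\<Sum>y\<in>?S. pmf \<mu> y * w y)
      * ln ((\<Sum>y\<in>?S. pmf \<mu> y * exp (g y)) / (\<Sum>y\<in>?S. pmf \<mu> y * w y))"
    using finite_support w_range by (intro log_sum_inequality) (auto simp: pmf_positive)
  finally show ?thesis
    unfolding p_def expectation_eq_sum_pmf[OF finite_support order_refl] .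
qed

section \<open>Cheeger's inequality for symmetric kernels\<close>

text \<open>The proof peels off the lowest positive level of \<open>h\<close>.\<close>

lemma nonneg_layer_induct [consumes 2, case_names zero layer]:
  fixes h :: "'a \<Rightarrow> real"
  assumes "finite V" and "\<forall>v\<in>V. 0 \<le> h v"
    and zero: "\<And>h. \<forall>v\<in>V. h v = 0 \<Longrightarrow> P h"
    and layer: "\<And>h g m S. S \<subseteq> V \<Longrightarrow> 0 < m \<Longrightarrow> \<forall>v\<in>V. 0 \<le> g v \<Longrightarrow>
      \<forall>v\<in>V - S. g v = 0 \<Longrightarrow> P g \<Longrightarrow> \<forall>v. h v = g v + m * of_bool (v \<in> S) \<Longrightarrow> P h"
  shows "P h"
  using assms(2)
proof (induction "card {v\<in>V. h v \<noteq> 0}" arbitrary: h rule: less_induct)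
  case less
  define S where "S = {v\<in>V. h v \<noteq> 0}"
  have finite_S: "finite S" using \<open>finite V\<close> by (simp add: S_def)
  show ?case
  proof (cases "S = {}")
    case True
    then show ?thesis by (intro zero) (auto simp: S_def)
  next
    case False
    obtain w where w: "w \<in> S" and w_min: "\<And>v. v \<in> S \<Longrightarrow> h w \<le> h v"
      using finite_S False by (metis arg_min_if_finite(1) arg_min_least)
    define g where "g v = h v - h w * of_bool (v \<in> S)" for v
    have "{v\<in>V. g v \<noteq> 0} \<subseteq> S - {w}" using w by (auto simp: g_def S_def)
    then have "card {v\<in>V. g v \<noteq> 0} < card S"
      using finite_S w by (meson card_Diff1_less card_mono finite_Diff le_less_trans)
    moreover have g_nonneg: "\<forall>v\<in>V. 0 \<le> g v"
      using less.prems w_min by (auto simp: g_def)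
    ultimately have "P g" using less.hyps unfolding S_def by blast
    moreover have "0 < h w" using w less.prems by (auto simp: S_def order_le_less)
    moreover have "\<forall>v\<in>V - S. g v = 0" by (simp add: g_def S_def)
    moreover have "S \<subseteq> V" by (auto simp: S_def)
    ultimately show ?thesis using g_nonneg by (intro layer[of S "h w" g h]) (auto simp: g_def)
  qed
qed

lemma exists_median:
  fixes f :: "'a \<Rightarrow> 'b :: linorder"
  assumes "finite V" "V \<noteq> {}"
  obtains m where "2 * card {v\<in>V. m < f v} \<le> card V" "2 * card {v\<in>V. f v < m} \<le> card V"
proof -
  define A where "A = {t \<in> f ` V. 2 * card {v\<in>V. t < f v} \<le> card V}"
  have finite_A: "finite A" using assms by (simp add: A_def)
  have "Max (f ` V) \<in> f ` V" using assms by (intro Max_in) auto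
  moreover have "{v\<in>V. Max (f ` V) < f v} = {}" using assms by (auto simp: not_less)
  ultimately have "Max (f ` V) \<in> A"
    by (simp only: A_def mem_Collect_eq card.empty) simp
  then have Min_in_A: "Min A \<in> A" using finite_A by (intro Min_in) auto
  have "2 * card {v\<in>V. f v < Min A} \<le> card V"
  proof (cases "{v\<in>V. f v < Min A} = {}")
    case False
    let ?L = "{v\<in>V. f v < Min A}"
    have "Max (f ` ?L) \<in> f ` ?L" using False assms by (intro Max_in) auto
    then obtain w where w: "w \<in> ?L" and w_eq: "f w = Max (f ` ?L)" by auto
    have w_max: "f v \<le> f w" if "v \<in> ?L" for v using that assms by (simp add: w_eq)
    have "f w \<notin> A" using w Min_le[OF finite_A, of "f w"] by auto
    then have many_above: "card V < 2 * card {v\<in>V. f w < f v}" using w by (simp add: A_def)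
    have "?L \<inter> {v\<in>V. f w < f v} = {}" using w_max by force
    then have "card ?L + card {v\<in>V. f w < f v} = card (?L \<union> {v\<in>V. f w < f v})"
      using assms by (simp add: card_Un_disjoint)
    also have "\<dots> \<le> card V" using assms by (intro card_mono) auto
    finally show ?thesis using many_above by linarith
  qed (simp only: card.empty)
  with Min_in_A show thesis by (intro that[of "Min A"]) (auto simp: A_def)
qed

lemma abs_diff_squares_le:
  fixes a b \<phi> :: real
  assumes "0 \<le> \<phi>"
  shows "\<phi> * \<bar>a\<^sup>2 - b\<^sup>2\<bar> \<le> (a - b)\<^sup>2 + \<phi>\<^sup>2 / 2 * (a\<^sup>2 + b\<^sup>2)"
proof -
  have "\<phi> * \<bar>a\<^sup>2 - b\<^sup>2\<bar> = 2 * \<bar>a - b\<bar> * (\<phi> / 2 * \<bar>a + b\<bar>)"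
    by (simp add: power2_eq_square square_diff_square_factored abs_mult)
  also have "\<dots> \<le> (a - b)\<^sup>2 + \<phi>\<^sup>2 / 4 * (a + b)\<^sup>2"
    using sum_squares_bound[of "\<bar>a - b\<bar>" "\<phi> / 2 * \<bar>a + b\<bar>"]
    by (simp add: power_mult_distrib power_divide)
  also have "\<dots> \<le> (a - b)\<^sup>2 + \<phi>\<^sup>2 / 4 * (2 * (a\<^sup>2 + b\<^sup>2))"
    using sum_squares_bound[of a b] by (intro add_left_mono mult_left_mono) (auto simp: power2_sum)
  finally show ?thesis by (simp add: field_simps)
qed

lemma diff_pos_neg_parts_le:
  fixes a b :: real
  shows "(max 0 a - max 0 b)\<^sup>2 + (max 0 (- a) - max 0 (- b))\<^sup>2 \<le> (a - b)\<^sup>2"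
proof -
  define p q where "p = max 0 a - max 0 b" and "q = max 0 (- b) - max 0 (- a)"
  have "p \<le> 0 \<and> q \<le> 0 \<or> 0 \<le> p \<and> 0 \<le> q" by (auto simp: p_def q_def max_def)
  then have "0 \<le> p * q" by (auto intro: mult_nonneg_nonneg mult_nonpos_nonpos)
  moreover have "a - b = p + q" by (auto simp: p_def q_def max_def)
  then have "(a - b)\<^sup>2 = p\<^sup>2 + q\<^sup>2 + 2 * (p * q)" by (simp add: power2_sum)
  moreover have "q\<^sup>2 = (max 0 (- a) - max 0 (- b))\<^sup>2" by (simp add: q_def power2_commute)
  ultimately show ?thesis by (simp add: p_def)
qed

locale symmetric_kernel =
  fixes V :: "'a set" and K :: "'a \<Rightarrow> 'a \<Rightarrow> real"
  assumes finite_V: "finite V"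
    and kernel_nonneg: "u \<in> V \<Longrightarrow> v \<in> V \<Longrightarrow> 0 \<le> K u v"
    and kernel_commute: "u \<in> V \<Longrightarrow> v \<in> V \<Longrightarrow> K u v = K v u"
    and sum_kernel: "u \<in> V \<Longrightarrow> (\<Sum>v\<in>V. K u v) = 1"
begin

definition boundary :: "'a set \<Rightarrow> real" where
  "boundary C = (\<Sum>u\<in>C. \<Sum>v\<in>V - C. K u v)"

definition dirichlet_form :: "('a \<Rightarrow> real) \<Rightarrow> real" where
  "dirichlet_form f = (\<Sum>u\<in>V. \<Sum>v\<in>V. K u v * (f u - f v)\<^sup>2)"

definition lazy_op :: "('a \<Rightarrow> real) \<Rightarrow> 'a \<Rightarrow> real" where
  "lazy_op f v = f v / 2 + (\<Sum>u\<in>V. K v u * f u) / 2"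

lemma sum_kernel_left: "(\<Sum>u\<in>V. \<Sum>v\<in>V. K u v * g u) = (\<Sum>u\<in>V. g u)"
  by (simp add: sum_distrib_right[symmetric] sum_kernel)

lemma sum_kernel_swap: "(\<Sum>u\<in>V. \<Sum>v\<in>V. K u v * F u v) = (\<Sum>u\<in>V. \<Sum>v\<in>V. K u v * F v u)"
  by (subst sum.swap) (simp add: kernel_commute)

lemma sum_kernel_right: "(\<Sum>u\<in>V. \<Sum>v\<in>V. K u v * g v) = (\<Sum>u\<in>V. g u)"
  by (subst sum_kernel_swap) (rule sum_kernel_left)

lemma boundary_eq:
  assumes "C \<subseteq> V"
  shows "boundary C = (\<Sum>u\<in>V. \<Sum>v\<in>V. K u v * of_bool (u \<in> C \<and> v \<notin> C))"
proof -
  have "(\<Sum>v\<in>V. K u v * of_bool (u \<in> C \<and> v \<notin> C)) = (if u \<in> C then \<Sum>v\<in>V - C. K u v else 0)" for u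
    using finite_V by (auto simp: of_bool_def sum.If_cases Diff_eq Int_def intro!: sum.mono_neutral_cong_right)
  then show ?thesis
    using finite_V assms by (simp add: boundary_def sum.If_cases Int_absorb1)
qed

lemma lazy_op_const: "v \<in> V \<Longrightarrow> lazy_op (\<lambda>_. c) v = c"
  by (simp add: lazy_op_def sum_distrib_right[symmetric] sum_kernel)

lemma lazy_op_diff: "lazy_op (\<lambda>v. f v - g v) v = lazy_op f v - lazy_op g v"
  by (simp add: lazy_op_def right_diff_distrib sum_subtractf diff_divide_distrib)

lemma lazy_op_square_le:
  assumes "v \<in> V"
  shows "4 * (lazy_op f v)\<^sup>2 \<le> (\<Sum>u\<in>V. K v u * (f v + f u)\<^sup>2)"
proof -
  have "2 * lazy_op f v = (\<Sum>u\<in>V. K v u *\<^sub>R (f v + f u))"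
    by (simp add: lazy_op_def distrib_left sum.distrib sum_distrib_right[symmetric] sum_kernel assms)
  then have "(2 * lazy_op f v)\<^sup>2 = (\<Sum>u\<in>V. K v u *\<^sub>R (f v + f u))\<^sup>2" by (rule arg_cong)
  also have "\<dots> \<le> (\<Sum>u\<in>V. K v u * (f v + f u)\<^sup>2)"
    using assms finite_V by (intro convex_on_sum[OF _ _ convex_power2]) (auto simp: kernel_nonneg sum_kernel)
  finally show ?thesis by (simp add: power_mult_distrib)
qed

lemma sum_lazy_op_square_le:
  "4 * (\<Sum>v\<in>V. (lazy_op f v)\<^sup>2) \<le> 4 * (\<Sum>v\<in>V. (f v)\<^sup>2) - dirichlet_form f"
proof -
  have "4 * (\<Sum>v\<in>V. (lazy_op f v)\<^sup>2) \<le> (\<Sum>v\<in>V. \<Sum>u\<in>V. K v u * (f v + f u)\<^sup>2)"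
    unfolding sum_distrib_left by (intro sum_mono lazy_op_square_le)
  also have "\<dots> = (\<Sum>v\<in>V. \<Sum>u\<in>V. K v u * (2 * (f v)\<^sup>2) + K v u * (2 * (f u)\<^sup>2) - K v u * (f v - f u)\<^sup>2)"
    by (intro sum.cong refl) (simp add: power2_eq_square algebra_simps)
  also have "\<dots> = 4 * (\<Sum>v\<in>V. (f v)\<^sup>2) - dirichlet_form f"
    unfolding dirichlet_form_def
    by (simp only: sum.distrib sum_subtractf sum_kernel_left sum_kernel_right sum_distrib_left[symmetric])
  finally show ?thesis .
qed

end

locale expanding_kernel = symmetric_kernel +
  fixes \<phi> :: real
  assumes expansion_pos: "0 < \<phi>"
    and expansion: "C \<subseteq> V \<Longrightarrow> 2 * card C \<le> card V \<Longrightarrow> \<phi> * card C \<le> boundary C"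
begin

lemma coarea_le:
  assumes nonneg: "\<forall>v\<in>V. 0 \<le> h v" and small: "2 * card {v\<in>V. 0 < h v} \<le> card V"
  shows "\<phi> * (\<Sum>v\<in>V. h v) \<le> (\<Sum>u\<in>V. \<Sum>v\<in>V. K u v * max 0 (h u - h v))"
  using finite_V nonneg small
proof (induction h rule: nonneg_layer_induct)
  case (zero h)
  then show ?case by simp
next
  case (layer h g m S)
  note S_subset = layer.hyps(1) and m_pos = layer.hyps(2)
  have g_nonneg: "0 \<le> g v" if "v \<in> V" for v using layer.hyps(3) that by blast
  have g_outside: "g v = 0" if "v \<in> V" "v \<notin> S" for v using layer.hyps(4) that by blast
  have h_eq: "h v = g v + m * of_bool (v \<in> S)" for v using layer.hyps(5) by blast
  have "0 < h v \<longleftrightarrow> v \<in> S" if "v \<in> V" for v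
    using g_nonneg[OF that] g_outside[OF that] m_pos by (simp add: h_eq add_nonneg_pos)
  then have support: "{v\<in>V. 0 < h v} = S" using S_subset by blast
  have "{v\<in>V. 0 < g v} \<subseteq> S" using g_outside by force
  then have "card {v\<in>V. 0 < g v} \<le> card S"
    using finite_subset[OF S_subset finite_V] by (rule card_mono[rotated])
  then have g_bound: "\<phi> * (\<Sum>v\<in>V. g v) \<le> (\<Sum>u\<in>V. \<Sum>v\<in>V. K u v * max 0 (g u - g v))"
    using layer.IH layer.prems support by simp
  have "(\<Sum>v\<in>V. of_bool (v \<in> S)) = real (card S)"
    using finite_V S_subset by (simp add: of_bool_def sum.If_cases Int_absorb1)
  then have "\<phi> * (\<Sum>v\<in>V. h v) = \<phi> * (\<Sum>v\<in>V. g v) + m * (\<phi> * card S)"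
    by (simp add: h_eq sum.distrib sum_distrib_left[symmetric] algebra_simps)
  also have "\<dots> \<le> (\<Sum>u\<in>V. \<Sum>v\<in>V. K u v * max 0 (g u - g v)) + m * boundary S"
    using g_bound expansion[OF S_subset] layer.prems support m_pos by (intro add_mono mult_left_mono) auto
  also have "\<dots> = (\<Sum>u\<in>V. \<Sum>v\<in>V. K u v * (max 0 (g u - g v) + m * of_bool (u \<in> S \<and> v \<notin> S)))"
    by (simp add: boundary_eq[OF S_subset] sum_distrib_left sum.distrib distrib_left mult.left_commute)
  also have "\<dots> = (\<Sum>u\<in>V. \<Sum>v\<in>V. K u v * max 0 (h u - h v))"
  proof -
    have "max 0 (g u - g v) + m * of_bool (u \<in> S \<and> v \<notin> S) = max 0 (h u - h v)"
      if "u \<in> V" "v \<in> V" for u v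
      using that g_nonneg[of u] g_nonneg[of v] g_outside[of u] g_outside[of v] m_pos
      by (cases "u \<in> S"; cases "v \<in> S") (simp_all add: h_eq max_def)
    then show ?thesis by (intro sum.cong refl) (simp only:)
  qed
  finally show ?case .
qed

lemma dirichlet_form_nonneg_ge:
  assumes nonneg: "\<And>v. v \<in> V \<Longrightarrow> 0 \<le> g v" and small: "2 * card {v\<in>V. 0 < g v} \<le> card V"
  shows "\<phi>\<^sup>2 * (\<Sum>v\<in>V. (g v)\<^sup>2) \<le> dirichlet_form g"
proof -
  let ?A = "\<Sum>u\<in>V. \<Sum>v\<in>V. K u v * max 0 ((g u)\<^sup>2 - (g v)\<^sup>2)"
  let ?N = "\<Sum>v\<in>V. (g v)\<^sup>2"
  have "{v\<in>V. 0 < (g v)\<^sup>2} = {v\<in>V. 0 < g v}" using nonneg by force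
  then have coarea: "\<phi> * ?N \<le> ?A"
    using coarea_le[of "\<lambda>v. (g v)\<^sup>2"] small by simp
  have "2 * ?A = ?A + (\<Sum>u\<in>V. \<Sum>v\<in>V. K u v * max 0 ((g v)\<^sup>2 - (g u)\<^sup>2))"
    by (subst (3) sum_kernel_swap) simp
  also have "\<dots> = (\<Sum>u\<in>V. \<Sum>v\<in>V. K u v * \<bar>(g u)\<^sup>2 - (g v)\<^sup>2\<bar>)"
    unfolding sum.distrib[symmetric] distrib_left[symmetric]
    by (intro sum.cong refl) (simp add: max_def)
  finally have "\<phi> * (2 * ?A) = (\<Sum>u\<in>V. \<Sum>v\<in>V. K u v * (\<phi> * \<bar>(g u)\<^sup>2 - (g v)\<^sup>2\<bar>))"
    by (simp add: sum_distrib_left mult.left_commute)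
  also have "\<dots> \<le> (\<Sum>u\<in>V. \<Sum>v\<in>V. K u v * ((g u - g v)\<^sup>2 + \<phi>\<^sup>2 / 2 * ((g u)\<^sup>2 + (g v)\<^sup>2)))"
    using expansion_pos by (intro sum_mono mult_left_mono abs_diff_squares_le kernel_nonneg) auto
  also have "\<dots> = dirichlet_form g + (\<Sum>u\<in>V. \<Sum>v\<in>V. K u v * (\<phi>\<^sup>2 / 2 * (g u)\<^sup>2))
      + (\<Sum>u\<in>V. \<Sum>v\<in>V. K u v * (\<phi>\<^sup>2 / 2 * (g v)\<^sup>2))"
    by (simp add: dirichlet_form_def distrib_left sum.distrib)
  also have "\<dots> = dirichlet_form g + \<phi>\<^sup>2 * ?N"
    unfolding sum_kernel_left sum_kernel_right
    by (simp add: sum_distrib_left sum.distrib[symmetric])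
  finally have "2 * (\<phi> * ?A) \<le> dirichlet_form g + \<phi>\<^sup>2 * ?N" by simp
  moreover have "\<phi> * (\<phi> * ?N) \<le> \<phi> * ?A"
    using coarea expansion_pos by (intro mult_left_mono) auto
  ultimately show ?thesis by (simp add: power2_eq_square mult.assoc)
qed

theorem cheeger_inequality:
  assumes mean: "(\<Sum>v\<in>V. f v) = 0"
  shows "\<phi>\<^sup>2 * (\<Sum>v\<in>V. (f v)\<^sup>2) \<le> dirichlet_form f"
proof (cases "V = {}")
  case False
  then obtain m where median: "2 * card {v\<in>V. m < f v} \<le> card V" "2 * card {v\<in>V. f v < m} \<le> card V"
    using exists_median[OF finite_V] by blast
  define g h where "g v = max 0 (f v - m)" and "h v = max 0 (- (f v - m))" for v
  have support: "{v\<in>V. 0 < g v} = {v\<in>V. m < f v}" "{v\<in>V. 0 < h v} = {v\<in>V. f v < m}"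
    by (auto simp: g_def h_def less_max_iff_disj)
  have "(g v)\<^sup>2 + (h v)\<^sup>2 = (f v)\<^sup>2 - 2 * m * f v + m\<^sup>2" for v
    by (auto simp: g_def h_def max_def power2_eq_square algebra_simps)
  then have "(\<Sum>v\<in>V. (g v)\<^sup>2) + (\<Sum>v\<in>V. (h v)\<^sup>2) = (\<Sum>v\<in>V. (f v)\<^sup>2) + card V * m\<^sup>2"
    using mean unfolding sum.distrib[symmetric]
    by (simp add: sum.distrib sum_subtractf sum_distrib_left[symmetric])
  then have "\<phi>\<^sup>2 * (\<Sum>v\<in>V. (f v)\<^sup>2) \<le> \<phi>\<^sup>2 * ((\<Sum>v\<in>V. (g v)\<^sup>2) + (\<Sum>v\<in>V. (h v)\<^sup>2))"
    by (intro mult_left_mono) auto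
  also have "\<dots> \<le> dirichlet_form g + dirichlet_form h"
    using dirichlet_form_nonneg_ge[of g] dirichlet_form_nonneg_ge[of h] median support
    by (simp add: g_def h_def distrib_left)
  also have "\<dots> = (\<Sum>u\<in>V. \<Sum>v\<in>V. K u v * ((g u - g v)\<^sup>2 + (h u - h v)\<^sup>2))"
    by (simp add: dirichlet_form_def sum.distrib distrib_left)
  also have "\<dots> \<le> dirichlet_form f"
    unfolding dirichlet_form_def
  proof (intro sum_mono mult_left_mono kernel_nonneg)
    show "(g u - g v)\<^sup>2 + (h u - h v)\<^sup>2 \<le> (f u - f v)\<^sup>2" for u v
      using diff_pos_neg_parts_le[of "f u - m" "f v - m"] by (simp add: g_def h_def)
  qed
  finally show ?thesis .
qed (unfold dirichlet_form_def, simp)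

lemma lazy_op_contraction:
  assumes "(\<Sum>v\<in>V. f v) = 0"
  shows "(\<Sum>v\<in>V. (lazy_op f v)\<^sup>2) \<le> (1 - \<phi>\<^sup>2 / 4) * (\<Sum>v\<in>V. (f v)\<^sup>2)"
  using sum_lazy_op_square_le[of f] cheeger_inequality[OF assms] by (simp add: algebra_simps)

end

section \<open>Lazy walks on regular expanders\<close>

lemma out_degree_with_proj: "out_degree (with_proj G) v = card {w. (v, w) \<in> parcs G}"
proof -
  have "out_arcs (with_proj G) v = Pair v ` {w. (v, w) \<in> parcs G}"
    by (auto simp: out_arcs_def)
  then show ?thesis by (simp add: out_degree_def card_image inj_on_def)
qed

lemma vol_regular_graph:
  assumes "regular_graph d G" "C \<subseteq> pverts G"
  shows "vol G C = d * card C"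
proof -
  have "out_degree (with_proj G) v = d" if "v \<in> C" for v
    using assms that by (auto simp: regular_graph_def)
  then show ?thesis by (simp add: vol_def)
qed

lemma conductance_le:
  assumes "finite (pverts G)" "C \<subseteq> pverts G" "0 < vol G C" "2 * vol G C \<le> vol G (pverts G)"
  shows "conductance G * vol G C \<le> cut_size G C"
proof -
  let ?Q = "{real (cut_size G C) / real (vol G C) | C.
     C \<subseteq> pverts G \<and> 0 < vol G C \<and> real (vol G C) \<le> real (vol G (pverts G)) / 2}"
  have "?Q \<subseteq> (\<lambda>C. real (cut_size G C) / real (vol G C)) ` Pow (pverts G)" by auto
  then have "finite ?Q" by (rule finite_subset) (simp add: assms(1))
  moreover have "real (cut_size G C) / real (vol G C) \<in> ?Q"
    using assms(2-4) by (auto intro!: exI[of _ C])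
  ultimately have "conductance G \<le> real (cut_size G C) / real (vol G C)"
    unfolding conductance_def by (rule Min_le)
  then show ?thesis using assms(3) by (simp add: pos_le_divide_eq)
qed

locale regular_expander =
  fixes G :: "'a pair_pre_digraph" and d :: nat and \<phi> :: real
  assumes regular: "regular_graph d G"
    and expander: "expander \<phi> G"
    and degree_pos: "0 < d"
    and conductance_pos: "0 < \<phi>"
begin

sublocale pair_graph G
  using regular by (simp add: regular_graph_def)

lemma card_neighbours: "u \<in> pverts G \<Longrightarrow> card {w. (u, w) \<in> parcs G} = d"
  using regular by (simp add: regular_graph_def out_degree_with_proj)

lemma neighbours_subset: "{w. (u, w) \<in> parcs G} \<subseteq> pverts G"
  using in_arcsD2 by blast

lemma neighbours_finite_nonempty:
  "u \<in> pverts G \<Longrightarrow> finite {w. (u, w) \<in> parcs G} \<and> {w. (u, w) \<in> parcs G} \<noteq> {}"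
  using card_neighbours[of u] degree_pos card_gt_0_iff[of "{w. (u, w) \<in> parcs G}"] by simp

lemma set_lazy_walk: "x \<in> pverts G \<Longrightarrow> set_pmf (lazy_walk G l x) \<subseteq> pverts G"
proof (induction l)
  case (Suc l)
  have "set_pmf (lazy_step G u) \<subseteq> pverts G" if "u \<in> pverts G" for u
  proof -
    have "set_pmf (pmf_of_set {w. (u, w) \<in> parcs G}) = {w. (u, w) \<in> parcs G}"
      using neighbours_finite_nonempty[OF that] by (intro set_pmf_of_set) auto
    then show ?thesis using that neighbours_subset[of u] by (auto simp: lazy_step_def split: if_splits)
  qed
  then show ?case using Suc by auto
qed simp

definition transition :: "'a \<Rightarrow> 'a \<Rightarrow> real" where
  "transition u v = of_bool ((u, v) \<in> parcs G) / d"

sublocale symmetric_kernel "pverts G" transition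
proof
  show "transition u v = transition v u" for u v
    using pair_sym_arcs by (auto simp: transition_def symmetric_def sym_def)
  show "(\<Sum>v\<in>pverts G. transition u v) = 1" if u: "u \<in> pverts G" for u
  proof -
    have "pverts G \<inter> {v. (u, v) \<in> parcs G} = {v. (u, v) \<in> parcs G}"
      using neighbours_subset by blast
    then show ?thesis
      using card_neighbours[OF u] degree_pos
      by (simp add: transition_def sum_divide_distrib[symmetric] of_bool_def sum.If_cases)
  qed
qed (simp_all add: transition_def)

lemma boundary_eq_cut_size:
  assumes "C \<subseteq> pverts G"
  shows "boundary C = cut_size G C / d"
proof -
  have "finite C" using assms pair_finite_verts by (rule finite_subset)
  have "boundary C = (\<Sum>(u, v)\<in>C \<times> (pverts G - C). of_bool ((u, v) \<in> parcs G)) / d"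
    by (simp add: boundary_def transition_def sum_divide_distrib sum.cartesian_product)
  also have "(\<Sum>(u, v)\<in>C \<times> (pverts G - C). of_bool ((u, v) \<in> parcs G))
    = real (card ((C \<times> (pverts G - C)) \<inter> parcs G))"
    using \<open>finite C\<close> by (simp add: of_bool_def case_prod_unfold sum.If_cases)
  also have "(C \<times> (pverts G - C)) \<inter> parcs G = {(u, v) \<in> parcs G. u \<in> C \<and> v \<in> pverts G - C}"
    by auto
  finally show ?thesis by (simp add: cut_size_def)
qed

sublocale expanding_kernel "pverts G" transition \<phi>
proof
  fix C assume small: "C \<subseteq> pverts G" "2 * card C \<le> card (pverts G)"
  have "conductance G * vol G C \<le> cut_size G C"
  proof (cases "card C = 0")
    case False
    have "2 * (d * card C) \<le> d * card (pverts G)"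
      using mult_left_mono[OF small(2), of d] by simp
    with False degree_pos show ?thesis
      by (intro conductance_le) (simp_all add: small(1) vol_regular_graph[OF regular])
  qed (simp add: vol_regular_graph[OF regular small(1)])
  then have "\<phi> * vol G C \<le> cut_size G C"
    using expander mult_right_mono[of \<phi> "conductance G" "vol G C"] by (simp add: expander_def)
  then show "\<phi> * card C \<le> boundary C"
    using degree_pos
    by (simp add: boundary_eq_cut_size[OF small(1)] vol_regular_graph[OF regular small(1)] field_simps)
qed (rule conductance_pos)

lemma pmf_lazy_step:
  assumes "v \<in> pverts G"
  shows "pmf (lazy_step G v) y = of_bool (v = y) / 2 + transition v y / 2"
  using neighbours_finite_nonempty[OF assms] card_neighbours[OF assms]
  by (simp add: lazy_step_def pmf_bind transition_def indicator_def)

lemma pmf_lazy_walk_Suc: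
  assumes x: "x \<in> pverts G" and y: "y \<in> pverts G"
  shows "pmf (lazy_walk G (Suc l) x) y = lazy_op (pmf (lazy_walk G l x)) y"
proof -
  let ?p = "pmf (lazy_walk G l x)"
  have "pmf (lazy_walk G (Suc l) x) y = (\<Sum>v\<in>pverts G. ?p v * pmf (lazy_step G v) y)"
    by (simp add: pmf_bind expectation_eq_sum_pmf[OF pair_finite_verts set_lazy_walk[OF x]])
  also have "\<dots> = (\<Sum>v\<in>pverts G. (if v = y then ?p v / 2 else 0) + transition y v * ?p v / 2)"
    by (intro sum.cong refl) (simp add: pmf_lazy_step kernel_commute[OF y] algebra_simps)
  also have "\<dots> = lazy_op ?p y"
    using y by (simp add: lazy_op_def sum.distrib sum_divide_distrib)
  finally show ?thesis .
qed

lemma lazy_walk_l2_le: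
  assumes x: "x \<in> pverts G" and \<phi>_le: "\<phi> \<le> 2"
  defines "N \<equiv> card (pverts G)"
  shows "(\<Sum>y\<in>pverts G. (pmf (lazy_walk G l x) y - 1 / N)\<^sup>2) \<le> (1 - \<phi>\<^sup>2 / 4) ^ l"
proof (induction l)
  case 0
  have N_pos: "0 < N" using x by (auto simp: N_def card_gt_0_iff)
  have "(\<Sum>y\<in>pverts G. (pmf (lazy_walk G 0 x) y - 1 / N)\<^sup>2)
    = (\<Sum>y\<in>pverts G. of_bool (y = x) * (1 - 2 / N) + 1 / N\<^sup>2)"
    by (intro sum.cong refl) (auto simp: indicator_def power2_diff power_divide)
  also have "\<dots> = 1 - 1 / N"
    using x N_pos by (simp add: sum.distrib sum_distrib_right[symmetric] of_bool_def N_def[symmetric])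
       (simp add: power2_eq_square field_simps)
  finally show ?case by simp
next
  case (Suc l)
  let ?f = "\<lambda>y. pmf (lazy_walk G l x) y - 1 / N"
  have mean: "(\<Sum>y\<in>pverts G. ?f y) = 0"
    using x sum_pmf_eq_1[OF pair_finite_verts set_lazy_walk[OF x]]
    by (auto simp: sum_subtractf N_def card_gt_0_iff)
  have "(\<Sum>y\<in>pverts G. (pmf (lazy_walk G (Suc l) x) y - 1 / N)\<^sup>2) = (\<Sum>y\<in>pverts G. (lazy_op ?f y)\<^sup>2)"
    by (intro sum.cong refl) (simp only: pmf_lazy_walk_Suc[OF x] lazy_op_diff lazy_op_const)
  also have "\<dots> \<le> (1 - \<phi>\<^sup>2 / 4) * (\<Sum>y\<in>pverts G. (?f y)\<^sup>2)"
    by (rule lazy_op_contraction[OF mean])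
  also have "\<dots> \<le> (1 - \<phi>\<^sup>2 / 4) * (1 - \<phi>\<^sup>2 / 4) ^ l"
    using power_mono[OF \<phi>_le, of 2] conductance_pos by (intro mult_left_mono Suc) auto
  finally show ?case by simp
qed

lemma lazy_walk_l1_le:
  assumes x: "x \<in> pverts G" and \<phi>_le: "\<phi> \<le> 2"
  defines "N \<equiv> card (pverts G)"
  shows "(\<Sum>y\<in>pverts G. \<bar>pmf (lazy_walk G l x) y - 1 / N\<bar>) \<le> sqrt N * exp (- (\<phi>\<^sup>2 * l / 8))"
proof -
  let ?f = "\<lambda>y. pmf (lazy_walk G l x) y - 1 / N"
  have "(\<Sum>y\<in>pverts G. \<bar>?f y\<bar>)\<^sup>2 \<le> (\<Sum>y\<in>pverts G. (?f y)\<^sup>2) * N"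
    using sum_squared_le_sum_of_squares[of "\<lambda>y. \<bar>?f y\<bar>" "pverts G"] by (simp add: N_def)
  also have "\<dots> \<le> (1 - \<phi>\<^sup>2 / 4) ^ l * N"
    unfolding N_def by (intro mult_right_mono lazy_walk_l2_le x \<phi>_le) simp
  also have "\<dots> \<le> exp (- (\<phi>\<^sup>2 / 4)) ^ l * N"
    using power_mono[OF \<phi>_le, of 2] conductance_pos exp_ge_add_one_self[of "- (\<phi>\<^sup>2 / 4)"]
    by (intro mult_right_mono power_mono) auto
  also have "\<dots> = (sqrt N * exp (- (\<phi>\<^sup>2 * l / 8)))\<^sup>2"
    by (simp add: power_mult_distrib exp_of_nat_mult[symmetric] exp_double[symmetric] mult.commute)
  finally show ?thesis by (rule power2_le_imp_le) simp
qed

theorem lazy_walk_mixing: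
  assumes x: "x \<in> pverts G" and \<phi>_le: "\<phi> \<le> 2"
  shows "tv_dist_le (lazy_walk G l x) (pmf_of_set (pverts G))
    (sqrt (card (pverts G)) * exp (- (\<phi>\<^sup>2 * l / 8)))"
proof -
  have nonempty: "pverts G \<noteq> {}" using x by blast
  have "tv_dist_le (lazy_walk G l x) (pmf_of_set (pverts G))
      (\<Sum>y\<in>pverts G. \<bar>pmf (lazy_walk G l x) y - pmf (pmf_of_set (pverts G)) y\<bar>)"
    using nonempty by (intro tv_dist_le_l1 set_lazy_walk x) auto
  moreover have "(\<Sum>y\<in>pverts G. \<bar>pmf (lazy_walk G l x) y - pmf (pmf_of_set (pverts G)) y\<bar>)
    \<le> sqrt (card (pverts G)) * exp (- (\<phi>\<^sup>2 * l / 8))"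
    using lazy_walk_l1_le[OF x \<phi>_le, of l] nonempty by simp
  ultimately show ?thesis by (rule tv_dist_le_mono)
qed

end

lemma lazy_walk_closed_subgraph:
  assumes expander: "regular_expander H d \<phi>" and x: "x \<in> pverts H"
    and arcs: "\<And>u w. u \<in> pverts H \<Longrightarrow> (u, w) \<in> parcs G \<longleftrightarrow> (u, w) \<in> parcs H"
  shows "lazy_walk G l x = lazy_walk H l x"
proof (induction l)
  case (Suc l)
  interpret H: regular_expander H d \<phi> by (rule expander)
  have "lazy_step G u = lazy_step H u" if "u \<in> pverts H" for u
  proof -
    have "{w. (u, w) \<in> parcs G} = {w. (u, w) \<in> parcs H}" using arcs[OF that] by simp
    then show ?thesis by (simp only: lazy_step_def)
  qed
  then show ?case
    using Suc H.set_lazy_walk[OF x, of l] by (auto intro: bind_pmf_cong)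
qed simp

section \<open>The level-one inequality for random signs\<close>

lemma cosh_le_exp_half_square: "cosh x \<le> exp (x\<^sup>2 / 2)" for x :: real
proof -
  define y where "y = \<bar>x\<bar>"
  have "ln ((1 + exp (2 * y)) / 2) \<le> y + y\<^sup>2 / 2"
    using Hoeffdings_lemma_aux[of "2 * y" "1 / 2"] by (simp add: y_def field_simps power2_eq_square)
  then have "exp (ln ((1 + exp (2 * y)) / 2)) \<le> exp (y + y\<^sup>2 / 2)" by simp
  then have "(1 + exp (2 * y)) / 2 \<le> exp (y + y\<^sup>2 / 2)" by (simp add: add_pos_pos)
  then have "exp (- y) * ((1 + exp (2 * y)) / 2) \<le> exp (- y) * exp (y + y\<^sup>2 / 2)"
    by (intro mult_left_mono) auto
  moreover have "exp (- y) * ((1 + exp (2 * y)) / 2) = cosh y"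
    by (simp add: cosh_field_def distrib_left exp_add[symmetric])
  moreover have "cosh y = cosh x" by (simp add: y_def)
  ultimately show ?thesis by (simp add: y_def exp_add[symmetric])
qed

lemma level_one_inequality:
  fixes X :: "'j \<Rightarrow> 'a \<Rightarrow> real" and w :: "'a \<Rightarrow> real"
  assumes finite_support: "finite (set_pmf \<mu>)" and w_range: "\<And>y. 0 \<le> w y" "\<And>y. w y \<le> 1"
    and subgaussian: "\<And>b. measure_pmf.expectation \<mu> (\<lambda>y. exp (\<Sum>j\<in>J. b j * X j y))
      \<le> exp (\<Sum>j\<in>J. (b j)\<^sup>2 / 2)"
  defines "p \<equiv> measure_pmf.expectation \<mu> w"
  shows "(\<Sum>j\<in>J. (measure_pmf.expectation \<mu> (\<lambda>y. w y * X j y))\<^sup>2) \<le> 2 * p\<^sup>2 * ln (1 / p)"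
proof -
  note [simp] = integrable_measure_pmf_finite[OF finite_support]
  define c where "c j = measure_pmf.expectation \<mu> (\<lambda>y. w y * X j y)" for j
  define S where "S = (\<Sum>j\<in>J. (c j)\<^sup>2)"
  have "0 \<le> p" unfolding p_def using w_range by simp
  then consider (null) "p = 0" | (positive) "0 < p" by linarith
  then have "S \<le> 2 * p\<^sup>2 * ln (1 / p)"
  proof cases
    case null
    then have "AE y in \<mu>. w y = 0"
      using w_range by (subst (asm) p_def, subst (asm) integral_nonneg_eq_0_iff_AE) auto
    then have "c j = 0" for j unfolding c_def by (intro integral_eq_zero_AE) auto
    then show ?thesis by (simp add: S_def null)
  next
    case positive
    let ?Z = "measure_pmf.expectation \<mu> (\<lambda>y. exp (\<Sum>j\<in>J. c j / p * X j y))"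
    have "?Z \<le> exp (\<Sum>j\<in>J. (c j / p)\<^sup>2 / 2)" by (rule subgaussian)
    moreover have Z_pos: "0 < ?Z" by (rule expectation_exp_pos) simp
    ultimately have ln_Z: "ln ?Z \<le> S / (2 * p\<^sup>2)"
      using ln_le_cancel_iff[of ?Z "exp _"]
      by (simp add: S_def power_divide sum_divide_distrib mult.commute)
    have "S / p = (\<Sum>j\<in>J. c j / p * c j)"
      by (simp add: S_def power2_eq_square sum_divide_distrib)
    also have "\<dots> = measure_pmf.expectation \<mu> (\<lambda>y. w y * (\<Sum>j\<in>J. c j / p * X j y))"
      by (subst (2) c_def) (simp add: sum_distrib_left mult.left_commute)
    also have "\<dots> \<le> p * ln (?Z / p)"
      unfolding p_def by (rule expectation_mult_le_ln_mgf[OF finite_support w_range])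
    also have "\<dots> = p * (ln ?Z + ln (1 / p))"
      using positive Z_pos by (simp add: ln_div)
    also have "\<dots> \<le> p * (S / (2 * p\<^sup>2) + ln (1 / p))"
      using positive ln_Z by (intro mult_left_mono add_right_mono) auto
    finally show ?thesis using positive by (simp add: field_simps power2_eq_square)
  qed
  then show ?thesis by (simp add: S_def c_def)
qed

definition rademacher :: "'i set \<Rightarrow> ('i \<Rightarrow> int) pmf" where
  "rademacher A = Pi_pmf A 1 (\<lambda>_. pmf_of_set {-1, 1})"

lemma random_signs_eq_rademacher: "random_signs n = rademacher {1..n}"
  by (simp add: random_signs_def rademacher_def)

lemma finite_set_rademacher: "finite A \<Longrightarrow> finite (set_pmf (rademacher A))"
  unfolding rademacher_def
  by (rule finite_subset[OF set_Pi_pmf_subset']) (auto intro!: finite_PiE_dflt)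

lemma rademacher_mgf_le:
  fixes b :: "'i \<Rightarrow> real"
  assumes "finite A"
  shows "measure_pmf.expectation (rademacher A) (\<lambda>Y. exp (\<Sum>j\<in>A. b j * Y j))
    \<le> exp (\<Sum>j\<in>A. (b j)\<^sup>2 / 2)"
proof -
  let ?U = "pmf_of_set {-1, 1 :: int}"
  have "measure_pmf.expectation (rademacher A) (\<lambda>Y. exp (\<Sum>j\<in>A. b j * Y j))
    = measure_pmf.expectation (rademacher A) (\<lambda>Y. \<Prod>j\<in>A. exp (b j * Y j))"
    using assms by (simp add: exp_sum)
  also have "\<dots> = (\<Prod>j\<in>A. measure_pmf.expectation ?U (\<lambda>v. exp (b j * v)))"
    unfolding rademacher_def
    by (intro expectation_prod_Pi_pmf integrable_measure_pmf_finite assms) auto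
  also have "\<dots> = (\<Prod>j\<in>A. cosh (b j))"
    by (intro prod.cong refl) (simp add: integral_pmf_of_set cosh_field_def)
  also have "\<dots> \<le> (\<Prod>j\<in>A. exp ((b j)\<^sup>2 / 2))"
    by (intro prod_mono conjI cosh_le_exp_half_square cosh_real_nonneg)
  finally show ?thesis using assms by (simp add: exp_sum)
qed

lemma rademacher_product_mgf_le:
  fixes b :: "'i \<Rightarrow> real"
  assumes "finite A" "i \<notin> A"
  shows "measure_pmf.expectation (rademacher (insert i A))
      (\<lambda>Y. exp (\<Sum>j\<in>A. b j * (Y i * Y j)))
    \<le> exp (\<Sum>j\<in>A. (b j)\<^sup>2 / 2)"
proof -
  let ?h = "\<lambda>Y :: 'i \<Rightarrow> int. exp (\<Sum>j\<in>A. b j * (Y i * Y j))"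
  have "rademacher (insert i A)
    = pmf_of_set {-1, 1} \<bind> (\<lambda>y. map_pmf (\<lambda>f. f(i := y)) (rademacher A))"
    unfolding rademacher_def by (simp add: Pi_pmf_insert'[OF assms] map_pmf_def)
  then have "measure_pmf.expectation (rademacher (insert i A)) ?h
    = (\<Sum>y\<in>{-1, 1}. measure_pmf.expectation (rademacher A) (\<lambda>f. ?h (f(i := y))) / 2)"
    using finite_set_rademacher[OF assms(1)] by (simp add: pmf_expectation_bind_pmf_of_set)
  also have "\<dots> \<le> (\<Sum>y\<in>{-1, 1 :: int}. exp (\<Sum>j\<in>A. (b j)\<^sup>2 / 2) / 2)"
  proof (intro sum_mono divide_right_mono)
    fix y :: int assume y: "y \<in> {-1, 1}"
    have "?h (f(i := y)) = exp (\<Sum>j\<in>A. (b j * y) * f j)" for f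
      using assms(2) by (intro arg_cong[where f = exp] sum.cong) auto
    then show "measure_pmf.expectation (rademacher A) (\<lambda>f. ?h (f(i := y))) \<le> exp (\<Sum>j\<in>A. (b j)\<^sup>2 / 2)"
      using rademacher_mgf_le[OF assms(1), of "\<lambda>j. b j * y"] y by auto
  qed simp
  finally show ?thesis by simp
qed

section \<open>Information about the hidden partition\<close>

lemma random_signs_cases:
  assumes "Y \<in> set_pmf (random_signs n)" "i \<in> {1..n}"
  obtains "Y i = 1" | "Y i = -1"
  using assms by (auto simp: random_signs_def set_Pi_pmf PiE_dflt_def)

lemma integrable_random_signs [simp]: "integrable (random_signs n) f"
  for f :: "_ \<Rightarrow> real"
  by (intro integrable_measure_pmf_finite) (simp add: random_signs_eq_rademacher finite_set_rademacher)

definition pair_index :: "nat \<Rightarrow> nat" where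
  "pair_index v = (v + 1) div 2"

definition side :: "(nat \<Rightarrow> int) \<Rightarrow> nat \<Rightarrow> int" where
  "side Y v = (if odd v then Y (pair_index v) else - Y (pair_index v))"

definition component :: "nat \<Rightarrow> (nat \<Rightarrow> int) \<Rightarrow> nat \<Rightarrow> nat set" where
  "component n Y x = (if x \<in> set1 n Y then set1 n Y else set2 n Y)"

lemma pair_index_range: "v \<in> {1..2 * n} \<Longrightarrow> pair_index v \<in> {1..n}"
  by (auto simp: pair_index_def)

lemma pair_index_odd: "1 \<le> i \<Longrightarrow> pair_index (2 * i - Suc 0) = i"
  by (simp add: pair_index_def)

lemma pair_index_even: "pair_index (2 * i) = i"
  by (simp add: pair_index_def)

lemma double_pair_index_odd: "odd v \<Longrightarrow> 2 * pair_index v - Suc 0 = v"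
  unfolding pair_index_def by presburger

lemma double_pair_index_even: "even v \<Longrightarrow> 2 * pair_index v = v"
  unfolding pair_index_def by presburger

lemma side_cases:
  assumes "Y \<in> set_pmf (random_signs n)" "v \<in> {1..2 * n}"
  obtains "side Y v = 1" | "side Y v = -1"
  using assms(1) pair_index_range[OF assms(2)]
  by (rule random_signs_cases; cases "odd v") (simp_all add: side_def that)

lemma side_eq_image:
  assumes Y: "Y \<in> set_pmf (random_signs n)" and \<sigma>: "\<sigma> = 1 \<or> \<sigma> = -1"
  shows "{v \<in> {1..2 * n}. side Y v = \<sigma>} = (\<lambda>i. if Y i = \<sigma> then 2 * i - 1 else 2 * i) ` {1..n}"
proof (intro equalityI subsetI)
  fix v assume v: "v \<in> {v \<in> {1..2 * n}. side Y v = \<sigma>}"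
  then have "pair_index v \<in> {1..n}" by (intro pair_index_range) simp
  moreover have "v = (if Y (pair_index v) = \<sigma> then 2 * pair_index v - 1 else 2 * pair_index v)"
    using v \<sigma>
    by (cases "odd v") (auto simp: side_def double_pair_index_odd double_pair_index_even)
  ultimately show "v \<in> (\<lambda>i. if Y i = \<sigma> then 2 * i - 1 else 2 * i) ` {1..n}"
    by (rule image_eqI[rotated])
next
  fix v assume "v \<in> (\<lambda>i. if Y i = \<sigma> then 2 * i - 1 else 2 * i) ` {1..n}"
  then obtain i where i: "i \<in> {1..n}" "v = (if Y i = \<sigma> then 2 * i - 1 else 2 * i)" by auto
  from Y i(1) show "v \<in> {v \<in> {1..2 * n}. side Y v = \<sigma>}"
    by (rule random_signs_cases) (use i \<sigma> in \<open>auto simp: side_def pair_index_odd pair_index_even\<close>)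
qed

lemma set1_eq:
  assumes "Y \<in> set_pmf (random_signs n)"
  shows "set1 n Y = {v \<in> {1..2 * n}. side Y v = 1}"
  using side_eq_image[OF assms, of 1] by (simp add: set1_def)

lemma set2_eq:
  assumes Y: "Y \<in> set_pmf (random_signs n)"
  shows "set2 n Y = {v \<in> {1..2 * n}. side Y v = -1}"
proof -
  have "Y i = 1 \<or> Y i = -1" if "i \<in> {1..n}" for i
    using Y that by (rule random_signs_cases) simp_all
  then have "set2 n Y = (\<lambda>i. if Y i = -1 then 2 * i - 1 else 2 * i) ` {1..n}"
    unfolding set2_def by (intro image_cong refl) fastforce
  then show ?thesis using side_eq_image[OF Y, of "-1"] by simp
qed

lemma card_component: "card (component n Y x) = n"
proof -
  have card_transversal: "card (f ` {1..n}) = n" if "\<And>i. i \<in> {1..n} \<Longrightarrow> pair_index (f i) = i" for f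
    using that by (subst card_image) (auto intro!: inj_on_inverseI[where g = pair_index])
  have "card (set1 n Y) = n" "card (set2 n Y) = n"
    unfolding set1_def set2_def
    by (rule card_transversal; simp add: pair_index_odd pair_index_even)+
  then show ?thesis by (simp add: component_def)
qed

lemma component_eq:
  assumes Y: "Y \<in> set_pmf (random_signs n)" and x: "x \<in> {1..2 * n}"
  shows "component n Y x = {v \<in> {1..2 * n}. side Y v = side Y x}"
  using Y x by (rule side_cases) (use x in \<open>auto simp: component_def set1_eq[OF Y] set2_eq[OF Y]\<close>)

lemma set_pmf_component:
  assumes "Y \<in> set_pmf (random_signs n)" "x \<in> {1..2 * n}"
  shows "set_pmf (pmf_of_set (component n Y x)) \<subseteq> {1..2 * n}"
proof -
  have "component n Y x \<noteq> {}" "finite (component n Y x)" "component n Y x \<subseteq> {1..2 * n}"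
    using assms(2) unfolding component_eq[OF assms] by auto
  then show ?thesis using set_pmf_of_set[of "component n Y x"] by simp
qed

lemma pmf_component:
  assumes Y: "Y \<in> set_pmf (random_signs n)" and x: "x \<in> {1..2 * n}" and a: "a \<in> {1..2 * n}"
  shows "pmf (pmf_of_set (component n Y x)) a = (1 + side Y x * side Y a) / (2 * n)"
proof -
  have "finite (component n Y x)" "component n Y x \<noteq> {}"
    using component_eq[OF Y x] x by auto
  then have "pmf (pmf_of_set (component n Y x)) a = indicator (component n Y x) a / n"
    by (simp add: card_component)
  also have "indicator (component n Y x) a = (1 + real_of_int (side Y x) * side Y a) / 2"
    using component_eq[OF Y x] a
    by (cases rule: side_cases[OF Y x]; cases rule: side_cases[OF Y a]) simp_all
  finally show ?thesis by simp
qed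

lemma sum_pair_index:
  fixes g :: "nat \<Rightarrow> real"
  shows "(\<Sum>v\<in>{1..2 * n}. g (pair_index v)) = 2 * (\<Sum>j\<in>{1..n}. g j)"
proof (induction n)
  case (Suc n)
  have "{1..2 * Suc n} = insert (2 * n + 1) (insert (2 * n + 2) {1..2 * n})" by auto
  then have "(\<Sum>v\<in>{1..2 * Suc n}. g (pair_index v))
    = g (pair_index (2 * n + 1)) + (g (pair_index (2 * n + 2)) + (\<Sum>v\<in>{1..2 * n}. g (pair_index v)))"
    by (simp only:) simp
  also have "\<dots> = 2 * g (Suc n) + (\<Sum>v\<in>{1..2 * n}. g (pair_index v))"
    by (simp add: pair_index_def)
  finally show ?case using Suc.IH by simp
qed simp

text \<open>
  In the application \<open>w Y\<close> is the probability, given the signs \<open>Y\<close>, that the memory is in a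
  certain state, and \<open>joint x a\<close> that moreover the query \<open>x\<close> is answered by \<open>a\<close>.
\<close>

locale likelihood =
  fixes n :: nat and w :: "(nat \<Rightarrow> int) \<Rightarrow> real"
  assumes likelihood_nonneg: "0 \<le> w Y" and likelihood_le_1: "w Y \<le> 1"
begin

definition evidence :: real where
  "evidence = measure_pmf.expectation (random_signs n) w"

definition joint :: "nat \<Rightarrow> nat \<Rightarrow> real" where
  "joint x a = measure_pmf.expectation (random_signs n)
     (\<lambda>Y. w Y * pmf (pmf_of_set (component n Y x)) a)"

definition sign_correlation :: "nat \<Rightarrow> nat \<Rightarrow> real" where
  "sign_correlation i j = measure_pmf.expectation (random_signs n) (\<lambda>Y. w Y * (Y i * Y j))"

definition side_correlation :: "nat \<Rightarrow> nat \<Rightarrow> real" where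
  "side_correlation x a = measure_pmf.expectation (random_signs n)
     (\<lambda>Y. w Y * (side Y x * side Y a))"

lemma evidence_nonneg: "0 \<le> evidence"
  using likelihood_nonneg by (simp add: evidence_def)

lemma sum_sign_correlation_square_le:
  assumes i: "i \<in> {1..n}"
  shows "(\<Sum>j\<in>{1..n}. (sign_correlation i j)\<^sup>2) \<le> evidence\<^sup>2 * (1 + 2 * ln (1 / evidence))"
proof -
  let ?A = "{1..n} - {i}"
  have signs: "random_signs n = rademacher (insert i ?A)"
    using i by (simp add: random_signs_eq_rademacher insert_absorb)
  have "sign_correlation i i = evidence"
    unfolding sign_correlation_def evidence_def
  proof (intro integral_cong_AE AE_pmfI)
    fix Y assume "Y \<in> set_pmf (random_signs n)"
    from this i show "w Y * (Y i * Y i) = w Y" by (rule random_signs_cases) simp_all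
  qed simp_all
  moreover have "(\<Sum>j\<in>?A. (sign_correlation i j)\<^sup>2) \<le> 2 * evidence\<^sup>2 * ln (1 / evidence)"
    unfolding sign_correlation_def evidence_def signs
    using rademacher_product_mgf_le[of ?A i]
    by (intro level_one_inequality likelihood_nonneg likelihood_le_1 finite_set_rademacher) auto
  ultimately show ?thesis
    using i by (simp add: sum.remove[of _ i] algebra_simps)
qed

lemma side_correlation_square:
  "(side_correlation x a)\<^sup>2 = (sign_correlation (pair_index x) (pair_index a))\<^sup>2"
proof -
  define c :: real where "c = (if even (x + a) then 1 else -1)"
  have side_product: "w Y * (side Y x * side Y a) = c * (w Y * (Y (pair_index x) * Y (pair_index a)))" for Y
    by (auto simp: side_def c_def)
  have "side_correlation x a = c * sign_correlation (pair_index x) (pair_index a)"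
    unfolding side_correlation_def sign_correlation_def side_product by simp
  then show ?thesis by (simp add: c_def power_mult_distrib)
qed

lemma sum_side_correlation_square_le:
  assumes "x \<in> {1..2 * n}"
  shows "(\<Sum>a\<in>{1..2 * n}. (side_correlation x a)\<^sup>2) \<le> 2 * (evidence\<^sup>2 * (1 + 2 * ln (1 / evidence)))"
  unfolding side_correlation_square sum_pair_index[of "\<lambda>j. (sign_correlation (pair_index x) j)\<^sup>2"]
  using sum_sign_correlation_square_le[OF pair_index_range[OF assms]] by simp

lemma joint_nonneg: "0 \<le> joint x a"
  unfolding joint_def using likelihood_nonneg by (intro integral_nonneg_AE AE_pmfI) simp

lemma joint_eq:
  assumes x: "x \<in> {1..2 * n}" and a: "a \<in> {1..2 * n}"
  shows "joint x a = (evidence + side_correlation x a) / (2 * n)"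
proof -
  have "joint x a = measure_pmf.expectation (random_signs n)
      (\<lambda>Y. (w Y + w Y * (side Y x * side Y a)) / (2 * n))"
    unfolding joint_def
    by (intro integral_cong_AE AE_pmfI) (auto simp: pmf_component[OF _ x a] algebra_simps)
  then show ?thesis by (simp add: evidence_def side_correlation_def)
qed

lemma expectation_answer:
  assumes x: "x \<in> {1..2 * n}"
  shows "measure_pmf.expectation (random_signs n)
      (\<lambda>Y. w Y * measure_pmf.expectation (pmf_of_set (component n Y x)) g)
    = (\<Sum>a\<in>{1..2 * n}. joint x a * g a)"
proof -
  have "measure_pmf.expectation (random_signs n)
      (\<lambda>Y. w Y * measure_pmf.expectation (pmf_of_set (component n Y x)) g)
    = measure_pmf.expectation (random_signs n)
      (\<lambda>Y. \<Sum>a\<in>{1..2 * n}. w Y * pmf (pmf_of_set (component n Y x)) a * g a)"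
  proof (intro integral_cong_AE AE_pmfI)
    fix Y assume Y: "Y \<in> set_pmf (random_signs n)"
    show "w Y * measure_pmf.expectation (pmf_of_set (component n Y x)) g
      = (\<Sum>a\<in>{1..2 * n}. w Y * pmf (pmf_of_set (component n Y x)) a * g a)"
      unfolding expectation_eq_sum_pmf[OF finite_atLeastAtMost set_pmf_component[OF Y x]]
      by (simp only: sum_distrib_left mult.assoc)
  qed simp_all
  also have "\<dots> = (\<Sum>a\<in>{1..2 * n}. joint x a * g a)" by (simp add: joint_def)
  finally show ?thesis .
qed

lemma sum_joint:
  assumes "x \<in> {1..2 * n}"
  shows "(\<Sum>a\<in>{1..2 * n}. joint x a) = evidence"
proof -
  have "(\<Sum>a\<in>{1..2 * n}. joint x a) = (\<Sum>a\<in>{1..2 * n}. joint x a * 1)" by simp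
  also have "\<dots> = evidence"
    unfolding expectation_answer[OF assms, symmetric] by (simp add: evidence_def)
  finally show ?thesis .
qed

lemma joint_chi_square_le:
  assumes x: "x \<in> {1..2 * n}"
  shows "2 * n * (\<Sum>a\<in>{1..2 * n}. (joint x a)\<^sup>2) / evidence - evidence
    \<le> evidence * (1 + 2 * ln (1 / evidence)) / n"
proof -
  let ?V = "{1..2 * n}" and ?C = "\<Sum>a\<in>{1..2 * n}. (side_correlation x a)\<^sup>2"
  have n_pos: "0 < n" using x by auto
  have "(\<Sum>a\<in>?V. (evidence + side_correlation x a) / (2 * n)) = evidence"
    using sum_joint[OF x] by (simp add: joint_eq[OF x])
  then have mean: "(\<Sum>a\<in>?V. side_correlation x a) = 0"
    using n_pos by (simp add: sum_divide_distrib[symmetric] sum.distrib field_simps)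
  have "(\<Sum>a\<in>?V. (joint x a)\<^sup>2)
    = (\<Sum>a\<in>?V. (evidence\<^sup>2 + 2 * evidence * side_correlation x a + (side_correlation x a)\<^sup>2)
        / (2 * n)\<^sup>2)"
    by (intro sum.cong refl) (simp add: joint_eq[OF x] power_divide power2_sum)
  also have "\<dots> = (2 * n * evidence\<^sup>2 + ?C) / (2 * n)\<^sup>2"
    using mean by (simp add: sum_divide_distrib[symmetric] sum.distrib sum_distrib_left[symmetric])
  finally have square_sum: "(\<Sum>a\<in>?V. (joint x a)\<^sup>2) = (2 * n * evidence\<^sup>2 + ?C) / (2 * n)\<^sup>2" .
  have "2 * n * (\<Sum>a\<in>?V. (joint x a)\<^sup>2) / evidence - evidence = ?C / (2 * n * evidence)"
    unfolding square_sum using n_pos by (cases "evidence = 0") (simp_all add: power2_eq_square field_simps)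
  also have "\<dots> \<le> 2 * (evidence\<^sup>2 * (1 + 2 * ln (1 / evidence))) / (2 * n * evidence)"
    using evidence_nonneg by (intro divide_right_mono sum_side_correlation_square_le x) simp
  also have "\<dots> = evidence * (1 + 2 * ln (1 / evidence)) / n"
    using n_pos by (cases "evidence = 0") (simp_all add: power2_eq_square field_simps)
  finally show ?thesis .
qed

theorem answer_information_le:
  assumes x: "x \<in> {1..2 * n}"
  shows "measure_pmf.expectation (random_signs n)
      (\<lambda>Y. w Y * measure_pmf.expectation (pmf_of_set (component n Y x)) g)
    \<le> evidence * ln (measure_pmf.expectation (pmf_of_set {1..2 * n}) (\<lambda>a. exp (g a)))
      + evidence * (1 + 2 * ln (1 / evidence)) / n"
proof -
  let ?V = "{1..2 * n}"
  have "?V \<noteq> {}" using x by auto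
  then have uniform: "measure_pmf.expectation (pmf_of_set ?V) (\<lambda>a. exp (g a))
    = (\<Sum>a\<in>?V. exp (g a)) / card ?V"
    by (rule integral_pmf_of_set) simp
  have "(\<Sum>a\<in>?V. joint x a * g a) \<le> evidence * ln ((\<Sum>a\<in>?V. exp (g a)) / card ?V)
      + (card ?V * (\<Sum>a\<in>?V. (joint x a)\<^sup>2) / evidence - evidence)"
    unfolding sum_joint[OF x, symmetric] by (intro sum_mult_le_chi_square joint_nonneg) simp
  also have "card ?V * (\<Sum>a\<in>?V. (joint x a)\<^sup>2) / evidence - evidence
    \<le> evidence * (1 + 2 * ln (1 / evidence)) / n"
    unfolding card_atLeastAtMost diff_Suc_1 by (rule joint_chi_square_le[OF x])
  finally show ?thesis
    unfolding uniform expectation_answer[OF x] by simp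
qed

end

lemma pmf_answer_information_le:
  fixes m :: "(nat \<Rightarrow> int) \<Rightarrow> 's pmf" and s :: 's
  assumes "x \<in> {1..2 * n}"
  defines "p \<equiv> pmf (random_signs n \<bind> m) s"
  shows "measure_pmf.expectation (random_signs n) (\<lambda>Y. pmf (m Y) s
      * measure_pmf.expectation (map_pmf u (pmf_of_set (component n Y x))) g)
    \<le> p * ln (measure_pmf.expectation (map_pmf u (pmf_of_set {1..2 * n})) (\<lambda>a. exp (g a)))
      + p * (1 + 2 * ln (1 / p)) / n"
proof -
  interpret likelihood n "\<lambda>Y. pmf (m Y) s" by unfold_locales (simp_all add: pmf_le_1)
  have "evidence = p" by (simp add: evidence_def p_def pmf_bind)
  then show ?thesis
    using answer_information_le[OF assms(1), of "\<lambda>a. g (u a)"] by simp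
qed

section \<open>Memory contents under idealised answers\<close>

primrec memory_under :: "(nat \<Rightarrow> nat pmf) \<Rightarrow> rw_program \<Rightarrow> nat \<Rightarrow> bool list pmf" where
  "memory_under K P 0 = return_pmf (start P)"
| "memory_under K P (Suc T) =
     memory_under K P T \<bind> (\<lambda>s. map_pmf (update P T s) (K (query P T s)))"

lemma memory_after_eq_memory_under: "memory_after G l P T = memory_under (lazy_walk G l) P T"
  by (induction T) simp_all

locale space_bounded_program =
  fixes P :: rw_program and M :: nat and V :: "nat set"
  assumes space: "uses_space P M" and queries: "queries_within P M V"
begin

abbreviation states :: "bool list set" where
  "states \<equiv> {s. length s = M}"

lemma finite_states: "finite states"
  using finite_lists_length_eq[of "UNIV :: bool set" M] by simp

lemma card_states: "card states = 2 ^ M"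
  using card_lists_length_eq[of "UNIV :: bool set" M] by simp

lemma query_in: "s \<in> states \<Longrightarrow> query P t s \<in> V"
  using queries by (simp add: queries_within_def)

lemma set_memory_under: "set_pmf (memory_under K P T) \<subseteq> states"
  using space by (induction T) (fastforce simp: uses_space_def)+

lemma sum_states_entropy_le:
  assumes "set_pmf r \<subseteq> states"
  shows "(\<Sum>s\<in>states. pmf r s * (1 + 2 * ln (1 / pmf r s))) \<le> 1 + 2 * real M * ln 2"
proof -
  note mass = sum_pmf_eq_1[OF finite_states assms]
  have "(\<Sum>s\<in>states. pmf r s * (1 + 2 * ln (1 / pmf r s)))
    = (\<Sum>s\<in>states. pmf r s) + 2 * (\<Sum>s\<in>states. pmf r s * ln (1 / pmf r s))"
    by (simp only: distrib_left sum.distrib sum_distrib_left mult.left_commute mult_1_right)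
  also have "\<dots> \<le> 1 + 2 * ln (card states)"
    using entropy_le_ln_card[OF finite_states _ mass] mass by simp
  also have "\<dots> = 1 + 2 * real M * ln 2" by (simp add: card_states ln_realpow)
  finally show ?thesis .
qed

lemma memory_under_tv_dist_le:
  assumes "\<And>x. x \<in> V \<Longrightarrow> tv_dist_le (K x) (K' x) \<epsilon>"
  shows "tv_dist_le (memory_under K P T) (memory_under K' P T) (T * \<epsilon>)"
proof (induction T)
  case 0
  then show ?case by (simp add: tv_dist_le_refl)
next
  case (Suc T)
  have "tv_dist_le (memory_under K P (Suc T)) (memory_under K' P (Suc T)) (T * \<epsilon> + \<epsilon>)"
    using set_memory_under unfolding memory_under.simps
    by (intro tv_dist_le_bind Suc tv_dist_le_map assms query_in) blast
  then show ?case by (simp add: distrib_right add.commute)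
qed

end

lemma memory_under_no_space:
  assumes "uses_space P 0"
  shows "memory_under K P T = return_pmf []"
proof -
  interpret space_bounded_program P 0 UNIV
    using assms by unfold_locales (simp_all add: queries_within_def)
  show ?thesis
    using set_memory_under[of K T] by (simp add: set_pmf_subset_singleton[symmetric])
qed

definition uniform_memory :: "nat \<Rightarrow> rw_program \<Rightarrow> nat \<Rightarrow> bool list pmf" where
  "uniform_memory n P T = memory_under (\<lambda>_. pmf_of_set {1..2 * n}) P T"

definition component_memory :: "nat \<Rightarrow> rw_program \<Rightarrow> nat \<Rightarrow> bool list pmf" where
  "component_memory n P T =
     random_signs n \<bind> (\<lambda>Y. memory_under (\<lambda>x. pmf_of_set (component n Y x)) P T)"

theorem relative_entropy_component_memory_le:
  assumes "uses_space P M" "queries_within P M {1..2 * n}"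
  shows "relative_entropy_le (component_memory n P T) (uniform_memory n P T)
    (T * ((1 + 2 * real M * ln 2) / n))"
proof (induction T)
  case 0
  then show ?case
    by (simp add: component_memory_def uniform_memory_def relative_entropy_le_return)
next
  case (Suc T)
  interpret space_bounded_program P M "{1..2 * n}" using assms by unfold_locales
  define m where "m Y = memory_under (\<lambda>x. pmf_of_set (component n Y x)) P T" for Y
  define k where "k K s = map_pmf (update P T s) (K (query P T s))" for K s
  let ?r = "random_signs n \<bind> m"
  let ?\<eta> = "\<lambda>s. pmf ?r s * (1 + 2 * ln (1 / pmf ?r s)) / n"
  have support: "set_pmf (m Y) \<subseteq> states" for Y unfolding m_def by (rule set_memory_under)
  have step: "relative_entropy_le
    (random_signs n \<bind> (\<lambda>Y. m Y \<bind> k (\<lambda>x. pmf_of_set (component n Y x))))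
    (uniform_memory n P T \<bind> k (\<lambda>_. pmf_of_set {1..2 * n}))
    (T * ((1 + 2 * real M * ln 2) / n) + (\<Sum>s\<in>states. ?\<eta> s))"
  proof (rule relative_entropy_le_bind[OF finite_states support])
    show "relative_entropy_le ?r (uniform_memory n P T) (T * ((1 + 2 * real M * ln 2) / n))"
      using Suc unfolding component_memory_def m_def[abs_def] .
    fix s g assume s: "s \<in> states"
    show "measure_pmf.expectation (random_signs n) (\<lambda>Y. pmf (m Y) s
        * measure_pmf.expectation (k (\<lambda>x. pmf_of_set (component n Y x)) s) g)
      \<le> pmf ?r s * ln (measure_pmf.expectation (k (\<lambda>_. pmf_of_set {1..2 * n}) s) (\<lambda>a. exp (g a)))
        + ?\<eta> s"
      unfolding k_def by (rule pmf_answer_information_le[OF query_in[OF s]])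
  qed
  have "set_pmf ?r \<subseteq> states" using support by auto
  then have "(\<Sum>s\<in>states. ?\<eta> s) \<le> (1 + 2 * real M * ln 2) / n"
    unfolding sum_divide_distrib[symmetric] by (intro divide_right_mono sum_states_entropy_le) auto
  with step have "relative_entropy_le
    (random_signs n \<bind> (\<lambda>Y. m Y \<bind> k (\<lambda>x. pmf_of_set (component n Y x))))
    (uniform_memory n P T \<bind> k (\<lambda>_. pmf_of_set {1..2 * n}))
    (Suc T * ((1 + 2 * real M * ln 2) / n))"
    by (elim relative_entropy_le_mono) (simp add: distrib_right add_divide_distrib)
  then show ?case
    by (simp only: component_memory_def uniform_memory_def memory_under.simps m_def k_def[abs_def])
qed

section \<open>The lower bound\<close>

lemma disjoint_union_component:
  assumes regular: "regular_graph d G"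
    and union: "pverts G = pverts H \<union> pverts H'" "parcs G = parcs H \<union> parcs H'"
    and expander: "pair_graph H" "expander \<phi> H" and rest: "pair_graph H'"
    and disjoint: "pverts H \<inter> pverts H' = {}" and pos: "0 < d" "0 < \<phi>"
  shows "regular_expander H d \<phi>"
    and "x \<in> pverts H \<Longrightarrow> lazy_walk G l x = lazy_walk H l x"
proof -
  interpret H': pair_graph H' by (rule rest)
  have arcs: "(u, w) \<in> parcs G \<longleftrightarrow> (u, w) \<in> parcs H" if "u \<in> pverts H" for u w
    using that disjoint H'.in_arcsD1[of u w] by (auto simp: union)
  have "out_degree (with_proj H) u = d" if "u \<in> pverts H" for u
  proof -
    have "out_degree (with_proj G) u = d" using regular that by (simp add: regular_graph_def union)
    then show ?thesis by (simp add: out_degree_with_proj arcs[OF that])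
  qed
  then show H_expander: "regular_expander H d \<phi>"
    using expander pos by unfold_locales (auto simp: regular_graph_def)
  show "lazy_walk G l x = lazy_walk H l x" if "x \<in> pverts H"
    by (rule lazy_walk_closed_subgraph[OF H_expander that arcs])
qed

lemma two_identical_expanders_component:
  assumes Y: "Y \<in> set_pmf (random_signs n)"
    and regular: "regular_graph d G"
    and copies: "two_identical_expanders \<phi> (set1 n Y) (set2 n Y) G"
    and pos: "0 < d" "0 < \<phi>" and x: "x \<in> {1..2 * n}"
  obtains H where "regular_expander H d \<phi>" "pverts H = component n Y x"
    "lazy_walk G l x = lazy_walk H l x"
proof -
  obtain H1 H2 where graphs: "pair_graph H1" "pair_graph H2"
    and expanders: "expander \<phi> H1" "expander \<phi> H2"
    and verts: "pverts H1 = set1 n Y" "pverts H2 = set2 n Y" "pverts G = pverts H1 \<union> pverts H2"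
    and arcs: "parcs G = parcs H1 \<union> parcs H2"
    using copies unfolding two_identical_expanders_def by blast
  have disjoint: "pverts H1 \<inter> pverts H2 = {}"
    by (auto simp: verts set1_eq[OF Y] set2_eq[OF Y])
  show thesis
  proof (cases "x \<in> set1 n Y")
    case True
    then show thesis
      using disjoint_union_component[OF regular verts(3) arcs graphs(1) expanders(1)
          graphs(2) disjoint pos]
      by (intro that[of H1]) (simp_all add: component_def verts)
  next
    case False
    have "x \<in> component n Y x" using component_eq[OF Y x] x by simp
    with False have "x \<in> pverts H2" by (simp add: component_def verts)
    then show thesis
      using False verts(3) arcs disjoint disjoint_union_component[of d G H2 H1, OF regular _ _
          graphs(2) expanders(2) graphs(1) _ pos]
      by (intro that[of H2]) (auto simp: component_def verts Un_commute Int_commute)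
  qed
qed

lemma prob_wrong_guess:
  fixes D :: "bool \<Rightarrow> bool pmf"
  shows "measure_pmf.prob (pmf_of_set UNIV \<bind> (\<lambda>X. map_pmf (Pair X) (D X))) {(X, guess). guess \<noteq> X}
    = (1 + pmf (D False) True - pmf (D True) True) / 2"
proof -
  let ?B = "{(X :: bool, guess). guess \<noteq> X}"
  have wrong: "measure_pmf.expectation (map_pmf (Pair X) (D X)) (indicator ?B) = pmf (D X) (\<not> X)" for X
  proof -
    have "(\<lambda>guess. indicator ?B (X, guess)) = (indicator {\<not> X} :: bool \<Rightarrow> real)"
      by (auto simp: indicator_def)
    then show ?thesis by (simp add: measure_pmf_single)
  qed
  have "measure_pmf.prob (pmf_of_set UNIV \<bind> (\<lambda>X. map_pmf (Pair X) (D X))) ?B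
    = measure_pmf.expectation (pmf_of_set UNIV \<bind> (\<lambda>X. map_pmf (Pair X) (D X))) (indicator ?B)"
    by simp
  also have "\<dots> = (\<Sum>X\<in>UNIV. pmf (D X) (\<not> X)) / 2"
    unfolding expectation_bind_pmf[OF bounded_range_indicator] wrong by (subst integral_pmf_of_set) auto
  also have "\<dots> = (1 + pmf (D False) True - pmf (D True) True) / 2"
    by (simp add: UNIV_bool pmf_False_conv_True)
  finally show ?thesis .
qed

definition verdict_pmf ::
    "nat \<Rightarrow> nat pair_pre_digraph \<Rightarrow> ((nat \<Rightarrow> int) \<Rightarrow> nat pair_pre_digraph) \<Rightarrow>
     nat \<Rightarrow> rw_program \<Rightarrow> nat \<Rightarrow> bool \<Rightarrow> bool pmf" where
  "verdict_pmf n G0 G1 l P T X =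
     input_graph n G0 G1 X \<bind> (\<lambda>G. map_pmf (verdict P) (memory_after G l P T))"

lemma verdict_pmf_no_space:
  assumes "uses_space P 0"
  shows "verdict_pmf n G0 G1 l P T X = return_pmf (verdict P [])"
  by (simp add: verdict_pmf_def memory_after_eq_memory_under memory_under_no_space[OF assms])

lemma error_prob_eq:
  "error_prob n G0 G1 l \<A> T = measure_pmf.expectation \<A> (\<lambda>P.
     (1 + pmf (verdict_pmf n G0 G1 l P T False) True - pmf (verdict_pmf n G0 G1 l P T True) True) / 2)"
proof -
  let ?B = "{(X :: bool, guess). guess \<noteq> X}"
  have "error_prob n G0 G1 l \<A> T = measure_pmf.prob (\<A> \<bind> (\<lambda>P. pmf_of_set UNIV \<bind>
      (\<lambda>X. map_pmf (Pair X) (verdict_pmf n G0 G1 l P T X)))) ?B"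
    unfolding error_prob_def verdict_pmf_def map_bind_pmf map_pmf_comp
    by (subst bind_commute_pmf[of \<A>]) (subst bind_commute_pmf[of \<A>], rule refl)
  also have "\<dots> = measure_pmf.expectation \<A> (\<lambda>P. measure_pmf.prob (pmf_of_set UNIV \<bind>
      (\<lambda>X. map_pmf (Pair X) (verdict_pmf n G0 G1 l P T X))) ?B)"
    using expectation_bind_pmf[OF bounded_range_indicator[of ?B], of \<A>] by simp
  finally show ?thesis by (simp only: prob_wrong_guess)
qed

locale hidden_partition_instance =
  fixes n d l :: nat and \<phi> :: real
    and G0 :: "nat pair_pre_digraph" and G1 :: "(nat \<Rightarrow> int) \<Rightarrow> nat pair_pre_digraph"
  assumes n_pos: "0 < n" and d_pos: "0 < d" and \<phi>_pos: "0 < \<phi>" and \<phi>_le: "\<phi> \<le> 2"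
    and G0: "pverts G0 = {1..2 * n}" "regular_graph d G0" "expander \<phi> G0"
    and G1: "\<And>Y. Y \<in> set_pmf (random_signs n) \<Longrightarrow> regular_graph d (G1 Y)"
      "\<And>Y. Y \<in> set_pmf (random_signs n) \<Longrightarrow> two_identical_expanders \<phi> (set1 n Y) (set2 n Y) (G1 Y)"
begin

definition mixing_error :: real where
  "mixing_error = sqrt (2 * n) * exp (- (\<phi>\<^sup>2 * l / 8))"

lemma G0_walk_mixing:
  assumes "x \<in> {1..2 * n}"
  shows "tv_dist_le (lazy_walk G0 l x) (pmf_of_set {1..2 * n}) mixing_error"
proof -
  interpret G0: regular_expander G0 d \<phi>
    using G0 d_pos \<phi>_pos by unfold_locales
  show ?thesis
    using G0.lazy_walk_mixing[of x l] assms \<phi>_le by (simp add: G0(1) mixing_error_def)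
qed

lemma G1_walk_mixing:
  assumes Y: "Y \<in> set_pmf (random_signs n)" and x: "x \<in> {1..2 * n}"
  shows "tv_dist_le (lazy_walk (G1 Y) l x) (pmf_of_set (component n Y x)) mixing_error"
proof -
  obtain H where expander: "regular_expander H d \<phi>"
    and H_eq: "pverts H = component n Y x" "lazy_walk (G1 Y) l x = lazy_walk H l x"
    by (rule two_identical_expanders_component[OF Y G1[OF Y] d_pos \<phi>_pos x])
  interpret H: regular_expander H d \<phi> by (rule expander)
  have "x \<in> pverts H" using component_eq[OF Y x] x by (simp add: H_eq)
  from H.lazy_walk_mixing[OF this \<phi>_le, of l]
  have "tv_dist_le (lazy_walk (G1 Y) l x) (pmf_of_set (component n Y x))
    (sqrt n * exp (- (\<phi>\<^sup>2 * l / 8)))"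
    by (simp add: H_eq card_component)
  then show ?thesis
    by (rule tv_dist_le_mono) (simp add: mixing_error_def)
qed

lemma verdict_advantage_le:
  assumes program: "uses_space P M" "queries_within P M {1..2 * n}"
    and \<delta>_range: "0 < \<delta>" "\<delta> \<le> 1"
  shows "pmf (verdict_pmf n G0 G1 l P T True) True - pmf (verdict_pmf n G0 G1 l P T False) True
    \<le> \<delta> + T * ((1 + 2 * real M * ln 2) / n) / \<delta> + 2 * (T * mixing_error)"
proof -
  interpret space_bounded_program P M "{1..2 * n}" using program by unfold_locales
  let ?accept = "{s. verdict P s}"
  have pmf_verdict: "pmf (map_pmf (verdict P) r) True = measure_pmf.prob r ?accept" for r
    by (simp add: pmf_map vimage_def)
  let ?r0 = "memory_under (lazy_walk G0 l) P T"
  let ?r1 = "random_signs n \<bind> (\<lambda>Y. memory_under (lazy_walk (G1 Y) l) P T)"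
  have "tv_dist_le ?r0 (uniform_memory n P T) (T * mixing_error)"
    unfolding uniform_memory_def by (intro memory_under_tv_dist_le G0_walk_mixing)
  then have connected: "\<bar>measure_pmf.prob ?r0 ?accept - measure_pmf.prob (uniform_memory n P T) ?accept\<bar>
    \<le> T * mixing_error"
    by (rule tv_dist_le_prob)
  have "tv_dist_le ?r1 (component_memory n P T) (0 + T * mixing_error)"
    unfolding component_memory_def
    by (intro tv_dist_le_bind tv_dist_le_refl memory_under_tv_dist_le G1_walk_mixing)
  then have split: "\<bar>measure_pmf.prob ?r1 ?accept - measure_pmf.prob (component_memory n P T) ?accept\<bar>
    \<le> 0 + T * mixing_error"
    by (rule tv_dist_le_prob)
  have "measure_pmf.prob (component_memory n P T) ?accept
    \<le> measure_pmf.prob (uniform_memory n P T) ?accept + \<delta> + T * ((1 + 2 * real M * ln 2) / n) / \<delta>"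
    by (intro relative_entropy_le_prob relative_entropy_component_memory_le program \<delta>_range)
  moreover have "pmf (verdict_pmf n G0 G1 l P T False) True = measure_pmf.prob ?r0 ?accept"
    by (simp add: verdict_pmf_def input_graph_def bind_return_pmf pmf_verdict memory_after_eq_memory_under)
  moreover have "pmf (verdict_pmf n G0 G1 l P T True) True = measure_pmf.prob ?r1 ?accept"
    unfolding pmf_verdict[symmetric]
    by (simp add: verdict_pmf_def input_graph_def bind_map_pmf map_bind_pmf memory_after_eq_memory_under)
  ultimately show ?thesis using connected split by (simp add: abs_le_iff)
qed

text \<open>The constants come from testing at accuracy \<open>\<delta> = 1 / 6\<close>.\<close>

lemma error_prob_ge:
  assumes programs: "\<And>P. P \<in> set_pmf \<A> \<Longrightarrow> uses_space P M \<and> queries_within P M {1..2 * n}"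
    and mixing: "mixing_error \<le> 2 / n"
  shows "5 / 12 - 11 * (real M * T / n) \<le> error_prob n G0 G1 l \<A> T"
proof -
  have "5 / 12 - 11 * (real M * T / n)
    \<le> (1 + pmf (verdict_pmf n G0 G1 l P T False) True - pmf (verdict_pmf n G0 G1 l P T True) True) / 2"
    if "P \<in> set_pmf \<A>" for P
  proof (cases "M = 0")
    \<comment> \<open>Without memory the entropy bound is still of order \<open>T / n\<close>, but the verdict is constant.\<close>
    case True
    then show ?thesis using programs[OF that] by (simp add: verdict_pmf_no_space)
  next
    case False
    have M_ge: "1 \<le> real M" using False by simp
    moreover have "2 * real M * ln 2 \<le> 2 * real M * 1"
      using ln_le_minus_one[of 2] by (intro mult_left_mono) auto
    ultimately have "1 + 2 * real M * ln 2 \<le> 3 * real M" by linarith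
    then have entropy: "T * ((1 + 2 * real M * ln 2) / n) / (1 / 6) \<le> 18 * (real M * T / n)"
      using mult_left_mono[of "1 + 2 * real M * ln 2" "3 * real M" "6 * T / n"] by (simp add: mult_ac)
    have "real T * mixing_error \<le> 1 * (real T * (2 / n))"
      using mixing by (simp only: mult_1) (intro mult_left_mono, auto)
    also have "\<dots> \<le> real M * (real T * (2 / n))" using M_ge by (intro mult_right_mono) auto
    finally show ?thesis
      using entropy programs[OF that] verdict_advantage_le[of P M "1 / 6" T] by (simp add: mult_ac)
  qed
  moreover have "\<bar>(1 + a - b) / 2\<bar> \<le> 1" if "0 \<le> a" "a \<le> 1" "0 \<le> b" "b \<le> 1" for a b :: real
    using that by (intro abs_leI) auto
  then have "\<bar>(1 + pmf p True - pmf q True) / 2\<bar> \<le> 1" for p q :: "bool pmf"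
    by (simp only: pmf_nonneg pmf_le_1)
  ultimately show ?thesis
    unfolding error_prob_eq
    by (intro measure_pmf.integral_ge_const integrable_pmf_bounded AE_pmfI)
       (auto simp only: bounded_iff real_norm_def)
qed

lemma space_times_queries_ge:
  assumes "\<And>P. P \<in> set_pmf \<A> \<Longrightarrow> uses_space P M \<and> queries_within P M {1..2 * n}"
    and "mixing_error \<le> 2 / n" and "error_prob n G0 G1 l \<A> T \<le> 1 / 3"
  shows "1 / 132 * n \<le> real M * T"
proof -
  have "5 / 12 - 11 * (real M * T / n) \<le> error_prob n G0 G1 l \<A> T"
    using assms(1,2) by (rule error_prob_ge)
  also have "\<dots> \<le> 1 / 3" by (rule assms(3))
  finally show ?thesis using n_pos by (simp add: field_simps)
qed

lemma mixing_error_le: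
  assumes \<phi>\<^sub>0: "0 < \<phi>\<^sub>0" "\<phi>\<^sub>0 \<le> \<phi>" and length: "16 / \<phi>\<^sub>0\<^sup>2 * ln n \<le> l"
  shows "mixing_error \<le> 2 / n"
proof -
  have "16 * ln n = \<phi>\<^sub>0\<^sup>2 * (16 / \<phi>\<^sub>0\<^sup>2 * ln n)" using \<phi>\<^sub>0 by simp
  also have "\<dots> \<le> \<phi>\<^sup>2 * l"
    using \<phi>\<^sub>0 length n_pos by (intro mult_mono power_mono) auto
  finally have "exp (- (\<phi>\<^sup>2 * l / 8)) \<le> exp (- (2 * ln n))" by simp
  also have "\<dots> = 1 / real n ^ 2"
    using n_pos by (simp add: exp_minus exp_double inverse_eq_divide)
  finally have decay: "exp (- (\<phi>\<^sup>2 * l / 8)) \<le> 1 / real n ^ 2" .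
  have "2 * real n * 1 \<le> 2 * real n * (2 * real n)" using n_pos by (intro mult_left_mono) auto
  then have "sqrt (2 * n) \<le> 2 * n"
    by (intro real_le_lsqrt) (auto simp: power2_eq_square)
  then have "mixing_error \<le> 2 * n * (1 / real n ^ 2)"
    unfolding mixing_error_def using decay by (intro mult_mono) auto
  then show ?thesis using n_pos by (simp add: power2_eq_square)
qed

end

theorem theorem9:
  fixes \<phi>\<^sub>0 :: real and D :: nat
  assumes "\<phi>\<^sub>0 > 0"
  shows "\<exists>C\<^sub>0>0. \<forall>C\<ge>C\<^sub>0. \<exists>c>0. \<exists>n\<^sub>0. \<forall>n\<ge>n\<^sub>0. \<forall>\<phi> d l G0 G1 \<A> M T.
           0 < \<phi> \<and> \<phi> < 1 \<and> \<phi>\<^sub>0 \<le> \<phi> \<and> 1 \<le> d \<and> d \<le> D \<and>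
           C\<^sub>0 * ln (real n) \<le> real l \<and> real l \<le> C * ln (real n) \<and>
           pverts G0 = {1..2 * n} \<and> regular_graph d G0 \<and> expander \<phi> G0 \<and>
           (\<forall>Y\<in>set_pmf (random_signs n).
              regular_graph d (G1 Y) \<and> two_identical_expanders \<phi> (set1 n Y) (set2 n Y) (G1 Y)) \<and>
           (\<forall>P\<in>set_pmf \<A>. uses_space P M \<and> queries_within P M {1..2 * n}) \<and>
           error_prob n G0 G1 l \<A> T \<le> 1/3
           \<longrightarrow> real M * real T \<ge> c * real n"
proof (rule exI[of _ "16 / \<phi>\<^sub>0\<^sup>2"], intro conjI allI impI exI[of _ "1 / 132 :: real"] exI[of _ "1 :: nat"];
    (elim conjE)?)
  show "0 < 16 / \<phi>\<^sub>0\<^sup>2" using assms by simp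
next
  fix n \<phi> d l G0 G1 \<A> M T
  assume "1 \<le> n" "0 < \<phi>" "\<phi> < 1" "1 \<le> d" "pverts G0 = {1..2 * n}" "regular_graph d G0"
    "expander \<phi> G0" "\<forall>Y\<in>set_pmf (random_signs n).
       regular_graph d (G1 Y) \<and> two_identical_expanders \<phi> (set1 n Y) (set2 n Y) (G1 Y)"
    and \<phi>\<^sub>0_le: "\<phi>\<^sub>0 \<le> \<phi>" and length: "16 / \<phi>\<^sub>0\<^sup>2 * ln (real n) \<le> real l"
    and programs: "\<forall>P\<in>set_pmf \<A>. uses_space P M \<and> queries_within P M {1..2 * n}"
    and error: "error_prob n G0 G1 l \<A> T \<le> 1/3"
  then interpret hidden_partition_instance n d l \<phi> G0 G1 by unfold_locales auto
  have "mixing_error \<le> 2 / n" by (rule mixing_error_le[OF assms \<phi>\<^sub>0_le length])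
  then show "1 / 132 * real n \<le> real M * real T"
    using programs error by (intro space_times_queries_ge) auto
qed simp

end
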